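(* Let $N\ge2$, $q>1$, $0\le\tau<1$, $\rho,\lambda\in\mathbb R$ and $\theta<-2$. Let $\Omega\subseteq\mathbb R^N$ be a domain with $0\in\Omega$. Then every positive solution $u$ of $\mathbb L_{\rho,\lambda,\tau}[u]=|x|^\theta u^q$ in $\Omega\setminus\{0\}$ satisfies $\lim_{|x|\to0}u(x)=0$, $u\in H^1_{\rm loc}(\Omega)$ and $$\mathbb L_{\rho,\lambda,\tau}[u]=\Delta u-(N-2+2\rho)\frac{x\cdot\nabla u}{|x|^2}+\lambda\,G_\tau(x,u,\nabla u)=|x|^\theta u^q\quad\text{in }\mathcal D'(\Omega).$$
   Context: For $x\ne0$, $z\ge0$, $\boldsymbol\xi\in\mathbb R^N$: $G_\tau(x,z,\boldsymbol\xi)=\frac{z^\tau|\boldsymbol\xi|^{1-\tau}}{|x|^{\tau+1}}$ if $0<\tau<1$ and $G_\tau(x,z,\boldsymbol\xi)=\frac{|\boldsymbol\xi|}{|x|}$ if $\tau=0$; $\mathbb L_{\rho,\lambda,\tau}[u]=\Delta u-(N-2+2\rho)\frac{x\cdot\nabla u}{|x|^2}+\lambda\,G_\tau(x,u,\nabla u)$. A positive solution in $\Omega\setminus\{0\}$ is a positive $u\in C^1(\Omega\setminus\{0\})$ satisfying the equation in the sense of distributions in $\Omega\setminus\{0\}$ (test functions in $C^1_c(\Omega\setminus\{0\})$). $\mathcal D'(\Omega)$ is the space of distributions on $\Omega$ (test functions may be non-zero at the origin). *)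

theory Defs
  imports "HOL-Analysis.Analysis"
begin

definition grad :: "('a::euclidean_space \<Rightarrow> real) \<Rightarrow> 'a \<Rightarrow> 'a" where
  "grad f x = (THE D. GDERIV f x :> D)"

definition laplacian :: "('a::euclidean_space \<Rightarrow> real) \<Rightarrow> 'a \<Rightarrow> real" where
  "laplacian f x = (\<Sum>b\<in>Basis. grad (\<lambda>y. grad f y \<bullet> b) x \<bullet> b)"

(* The space C^k(S); used only for open S. *)
primrec Ck_on :: "nat \<Rightarrow> 'a::euclidean_space set \<Rightarrow> ('a \<Rightarrow> real) \<Rightarrow> bool" where
  "Ck_on 0 S f \<longleftrightarrow> continuous_on S f"
| "Ck_on (Suc k) S f \<longleftrightarrow>
     (\<forall>x\<in>S. f differentiable (at x)) \<and> (\<forall>b\<in>Basis. Ck_on k S (\<lambda>x. grad f x \<bullet> b))"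

definition compactly_supported_in :: "'a::euclidean_space set \<Rightarrow> ('a \<Rightarrow> real) \<Rightarrow> bool" where
  "compactly_supported_in V \<phi> \<longleftrightarrow>
     compact (closure {x. \<phi> x \<noteq> 0}) \<and> closure {x. \<phi> x \<noteq> 0} \<subseteq> V"

(* Compactly supported functions on V are represented by their extension by 0. *)
definition C1_c :: "'a::euclidean_space set \<Rightarrow> ('a \<Rightarrow> real) set" where
  "C1_c V = {\<phi>. Ck_on 1 UNIV \<phi> \<and> compactly_supported_in V \<phi>}"

definition Cinf_c :: "'a::euclidean_space set \<Rightarrow> ('a \<Rightarrow> real) set" where
  "Cinf_c V = {\<phi>. (\<forall>k. Ck_on k UNIV \<phi>) \<and> compactly_supported_in V \<phi>}"

definition L1_loc :: "'a::euclidean_space set \<Rightarrow> ('a \<Rightarrow> real) set" where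
  "L1_loc V = {f. \<forall>K. compact K \<and> K \<subseteq> V \<longrightarrow> set_integrable lborel K f}"

definition L2 :: "'a::euclidean_space set \<Rightarrow> ('a \<Rightarrow> real) set" where
  "L2 V = {f. set_borel_measurable lborel V f \<and> set_integrable lborel V (\<lambda>x. (f x)\<^sup>2)}"

(* The distribution on V given by a function f; well defined for f in L1_loc V. *)
definition distr_of :: "'a::euclidean_space set \<Rightarrow> ('a \<Rightarrow> real) \<Rightarrow> ('a \<Rightarrow> real) \<Rightarrow> real" where
  "distr_of V f \<phi> = (LINT x:V|lborel. f x * \<phi> x)"

definition distr_partial ::
    "'a::euclidean_space \<Rightarrow> (('a \<Rightarrow> real) \<Rightarrow> real) \<Rightarrow> ('a \<Rightarrow> real) \<Rightarrow> real" where
  "distr_partial b T \<phi> = - T (\<lambda>x. grad \<phi> x \<bullet> b)"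

definition distr_laplacian ::
    "(('a::euclidean_space \<Rightarrow> real) \<Rightarrow> real) \<Rightarrow> ('a \<Rightarrow> real) \<Rightarrow> real" where
  "distr_laplacian T \<phi> = T (laplacian \<phi>)"

definition H1 :: "'a::euclidean_space set \<Rightarrow> ('a \<Rightarrow> real) set" where
  "H1 V = {f. f \<in> L2 V \<and>
     (\<forall>b\<in>Basis. \<exists>g\<in>L2 V. \<forall>\<phi>\<in>Cinf_c V. distr_partial b (distr_of V f) \<phi> = distr_of V g \<phi>)}"

definition H1_loc :: "'a::euclidean_space set \<Rightarrow> ('a \<Rightarrow> real) set" where
  "H1_loc \<Omega> = {f. \<forall>V. open V \<and> compact (closure V) \<and> closure V \<subseteq> \<Omega> \<longrightarrow> f \<in> H1 V}"

definition G :: "real \<Rightarrow> 'a::euclidean_space \<Rightarrow> real \<Rightarrow> 'a \<Rightarrow> real" where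
  "G \<tau> x z \<xi> =
     (if \<tau> = 0 then norm \<xi> / norm x
      else z powr \<tau> * norm \<xi> powr (1 - \<tau>) / norm x powr (\<tau> + 1))"

definition drift :: "real \<Rightarrow> ('a::euclidean_space \<Rightarrow> real) \<Rightarrow> 'a \<Rightarrow> real" where
  "drift \<rho> u x = (real DIM('a) - 2 + 2 * \<rho>) * ((x \<bullet> grad u x) / (norm x)\<^sup>2)"

(* L[u] = f tested against C^1_c(V), for u in C^1(V): the second derivatives in the
   Laplacian are moved onto the test function once. *)
definition L_equation_C1 ::
    "real \<Rightarrow> real \<Rightarrow> real \<Rightarrow> 'a::euclidean_space set \<Rightarrow> ('a \<Rightarrow> real) \<Rightarrow> ('a \<Rightarrow> real) \<Rightarrow> bool" where
  "L_equation_C1 \<rho> lam \<tau> V u f \<longleftrightarrow>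
     (\<forall>\<phi>\<in>C1_c V.
        (LINT x:V|lborel. - (grad u x \<bullet> grad \<phi> x) - drift \<rho> u x * \<phi> x
                            + lam * G \<tau> x (u x) (grad u x) * \<phi> x)
        = (LINT x:V|lborel. f x * \<phi> x))"

(* L[u] = f in D'(V). Every term has to be a distribution on V, which for the terms
   given by functions means local integrability. The pointwise gradient of u is only
   needed almost everywhere in V, so u may fail to be differentiable at the origin. *)
definition L_equation_distr ::
    "real \<Rightarrow> real \<Rightarrow> real \<Rightarrow> 'a::euclidean_space set \<Rightarrow> ('a \<Rightarrow> real) \<Rightarrow> ('a \<Rightarrow> real) \<Rightarrow> bool" where
  "L_equation_distr \<rho> lam \<tau> V u f \<longleftrightarrow>
     u \<in> L1_loc V \<and> drift \<rho> u \<in> L1_loc V \<and>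
     (\<lambda>x. lam * G \<tau> x (u x) (grad u x)) \<in> L1_loc V \<and> f \<in> L1_loc V \<and>
     (\<forall>\<phi>\<in>Cinf_c V.
        distr_laplacian (distr_of V u) \<phi> - distr_of V (drift \<rho> u) \<phi>
          + distr_of V (\<lambda>x. lam * G \<tau> x (u x) (grad u x)) \<phi>
        = distr_of V f \<phi>)"

definition positive_solution ::
    "real \<Rightarrow> real \<Rightarrow> real \<Rightarrow> real \<Rightarrow> real \<Rightarrow> 'a::euclidean_space set \<Rightarrow> ('a \<Rightarrow> real) \<Rightarrow> bool" where
  "positive_solution \<rho> lam \<tau> \<theta> q \<Omega> u \<longleftrightarrow>
     Ck_on 1 (\<Omega> - {0}) u \<and> (\<forall>x\<in>\<Omega> - {0}. 0 < u x) \<and>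
     L_equation_C1 \<rho> lam \<tau> (\<Omega> - {0}) u (\<lambda>x. norm x powr \<theta> * u x powr q)"

end

theory Submission
  imports Defs
begin

text \<open>
  Near the origin a Keller--Osserman bound holds: comparing \<open>u\<close> on the ball of radius
  \<open>R = \<bar>x\<^sub>0\<bar> / 2\<close> about \<open>x\<^sub>0\<close> with multiples of the large-solution barrier gives
  \<open>u\<^sup>q\<^sup>-\<^sup>1 \<le> C \<bar>x\<bar> powr (- \<theta> - 2)\<close>, because \<open>G\<close> is homogeneous of degree one in \<open>(u, \<nabla>u)\<close> and
  bounded by \<open>(u / \<bar>x\<bar> + \<bar>\<nabla>u\<bar>) / \<bar>x\<bar>\<close>. As \<open>\<theta> < - 2\<close>, this is a decay \<open>u \<le> C \<bar>x\<bar> powr \<gamma>\<close> with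
  \<open>\<gamma> > 0\<close>. Testing with \<open>u\<close> times a weight \<open>\<bar>x\<bar> powr (- \<gamma>)\<close> then bounds the integral of
  \<open>\<bar>x\<bar> powr (- \<gamma>) \<bar>\<nabla>u\<bar>\<^sup>2\<close>, so that \<open>\<bar>\<nabla>u\<bar> / \<bar>x\<bar>\<close> and all terms of the equation are integrable at the
  origin. Cutoffs with gradient \<open>O(1 / \<bar>x\<bar>)\<close> therefore remove the singularity by dominated convergence.
\<close>

subsection \<open>Weak calculus with compactly supported test functions\<close>

text \<open>For 0 < \<tau> < 1 the term \<open>G\<close> is not Lipschitz in the gradient where the
  gradient vanishes, so no comparison principle for the full operator is invoked. The barrier is
  compared with \<open>u\<close> at a single touching point: value and gradient agree there, which
  makes all lower-order terms explicit. As \<open>u\<close> is only C^1, the inequality between the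
  second-order parts has to come from testing the weak equation near that point. The assumption on
  \<theta> enters as positivity of (- \<theta> - 2) / (q - 1), and \<gamma> is this number capped at
  1. The energy estimate needs |x|^(-\<gamma>) u^2 / |x|^2, which is at most C^2 |x|^(\<gamma> - 2):
  half of the decay of u^2 pays for the weight, the other half keeps the bound integrable even in
  the plane. Dimension 2 is also what calls for the weight: without it |grad u| / |x| would be split
  into |grad u|^2 and |x|^(-2), and the latter is not integrable in the plane; with it the two
  pieces are |x|^(-\<gamma>) |grad u|^2 and |x|^(\<gamma> - 2).\<close>

lemma grad_eq:
  assumes "GDERIV f x :> D"
  shows "grad f x = D"
  unfolding grad_def
proof (rule the_equality)
  show "GDERIV f x :> D"
    by (rule assms)
  fix E assume "GDERIV f x :> E"
  then have "(\<lambda>h. h \<bullet> E) = (\<lambda>h. h \<bullet> D)"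
    using assms has_derivative_unique unfolding gderiv_def by blast
  then show "E = D"
    by (metis inner_commute vector_eq_rdot)
qed

lemma GDERIV_grad:
  fixes f :: "'a::euclidean_space \<Rightarrow> real"
  assumes "f differentiable (at x)"
  shows "GDERIV f x :> grad f x"
proof -
  obtain f' where f': "(f has_derivative f') (at x)"
    using assms by (auto simp: differentiable_def)
  then interpret f': bounded_linear f'
    by (rule has_derivative_bounded_linear)
  have "f' = (\<lambda>h. h \<bullet> (\<Sum>b\<in>Basis. f' b *\<^sub>R b))"
  proof
    fix h :: 'a
    have "f' h = f' (\<Sum>b\<in>Basis. (h \<bullet> b) *\<^sub>R b)"
      by (simp add: euclidean_representation)
    also have "\<dots> = h \<bullet> (\<Sum>b\<in>Basis. f' b *\<^sub>R b)"
      by (simp add: f'.sum f'.scaleR inner_sum_right mult.commute)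
    finally show "f' h = h \<bullet> (\<Sum>b\<in>Basis. f' b *\<^sub>R b)" .
  qed
  then have "GDERIV f x :> (\<Sum>b\<in>Basis. f' b *\<^sub>R b)"
    using f' by (simp add: gderiv_def)
  then show ?thesis
    using grad_eq by metis
qed

lemma Ck_on_1:
  fixes f :: "'a::euclidean_space \<Rightarrow> real"
  shows "Ck_on 1 S f \<longleftrightarrow> (\<forall>x\<in>S. GDERIV f x :> grad f x) \<and> continuous_on S (grad f)"
proof -
  have "f differentiable (at x) \<longleftrightarrow> GDERIV f x :> grad f x" for x
    using GDERIV_grad by (auto simp: gderiv_def differentiable_def)
  then show ?thesis
    by (auto simp: continuous_on_componentwise[of S "grad f"])
qed

lemma GDERIV_continuous_on:
  fixes f :: "'a::euclidean_space \<Rightarrow> real"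
  assumes "\<And>x. x \<in> S \<Longrightarrow> GDERIV f x :> D x"
  shows "continuous_on S f"
  using assms has_derivative_continuous unfolding gderiv_def
  by (metis continuous_at_imp_continuous_on)

lemma GDERIV_transform_open:
  assumes "GDERIV f x :> D" "open S" "x \<in> S" "\<And>y. y \<in> S \<Longrightarrow> g y = f y"
  shows "GDERIV g x :> D"
  using assms has_derivative_transform_within_open[of f "\<lambda>h. h \<bullet> D" x UNIV S g]
  unfolding gderiv_def by fastforce

lemma GDERIV_zero_outside:
  fixes f :: "'a::euclidean_space \<Rightarrow> real"
  assumes "closed K" "\<And>x. x \<notin> K \<Longrightarrow> f x = 0" "x \<notin> K"
  shows "GDERIV f x :> 0"
  by (rule GDERIV_transform_open[where f = "\<lambda>x. 0" and S = "- K"])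
     (use assms in \<open>auto simp: gderiv_def\<close>)

lemma continuous_on_zero_outside:
  fixes f :: "'a::topological_space \<Rightarrow> 'b::{t2_space,zero}"
  assumes "continuous_on V f" "open V" "closed K" "K \<subseteq> V" "\<And>x. x \<notin> K \<Longrightarrow> f x = 0"
  shows "continuous_on UNIV f"
proof -
  have "continuous_on (- K) f"
    by (rule continuous_on_eq[where f = "\<lambda>x. 0"]) (use assms in auto)
  with assms have "continuous_on (V \<union> - K) f"
    by (intro continuous_on_open_Un) auto
  moreover have "V \<union> - K = UNIV"
    using assms(4) by auto
  ultimately show ?thesis
    by simp
qed

text \<open>Derivative data are asked for on \<open>V\<close> only, so that formulas which are
  singular or unspecified outside \<open>V\<close>, for instance at the origin, can serve as test
  functions as long as they vanish off \<open>K\<close>.\<close>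

lemma C1_cI:
  fixes f :: "'a::euclidean_space \<Rightarrow> real"
  assumes "open V" "compact K" "K \<subseteq> V"
    and D: "\<And>x. x \<in> V \<Longrightarrow> GDERIV f x :> D x" "continuous_on V D"
    and 0: "\<And>x. x \<notin> K \<Longrightarrow> f x = 0"
  shows "f \<in> C1_c V"
proof -
  have "closed K"
    using assms compact_imp_closed by blast
  have out: "GDERIV f x :> 0" if "x \<notin> K" for x
    using GDERIV_zero_outside[OF \<open>closed K\<close> 0 that] .
  have grad_out: "grad f x = 0" if "x \<notin> K" for x
    using grad_eq[OF out[OF that]] .
  have "continuous_on V (grad f)"
    using D(2) by (rule continuous_on_eq) (simp add: grad_eq[OF D(1)])
  then have "continuous_on UNIV (grad f)"
    using continuous_on_zero_outside \<open>open V\<close> \<open>closed K\<close> \<open>K \<subseteq> V\<close> grad_out by blast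
  moreover have "GDERIV f x :> grad f x" for x
    by (cases "x \<in> K") (use D(1) out grad_eq \<open>K \<subseteq> V\<close> in \<open>metis subsetD\<close>)+
  ultimately have "Ck_on 1 UNIV f"
    by (simp only: Ck_on_1) simp
  moreover have "closure {x. f x \<noteq> 0} \<subseteq> K"
    using 0 \<open>closed K\<close> by (intro closure_minimal) auto
  then have "compactly_supported_in V f"
    unfolding compactly_supported_in_def
    using \<open>K \<subseteq> V\<close> \<open>compact K\<close> compact_closure bounded_subset compact_imp_bounded
    by (metis bounded_closure closed_closure compact_eq_bounded_closed subset_trans)
  ultimately show ?thesis
    by (simp add: C1_c_def)
qed

lemma C1_cE:
  fixes f :: "'a::euclidean_space \<Rightarrow> real"
  assumes "f \<in> C1_c V"
  obtains K where "compact K" "K \<subseteq> V" "\<And>x. x \<notin> K \<Longrightarrow> f x = 0"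
    "\<And>x. x \<notin> K \<Longrightarrow> grad f x = 0"
    "\<And>x. GDERIV f x :> grad f x" "continuous_on UNIV (grad f)" "continuous_on UNIV f"
proof -
  let ?K = "closure {x. f x \<noteq> 0}"
  have f: "Ck_on 1 UNIV f" and K: "compact ?K" "?K \<subseteq> V"
    using assms by (auto simp: C1_c_def compactly_supported_in_def)
  from f have D: "\<And>x. GDERIV f x :> grad f x" "continuous_on UNIV (grad f)"
    by (auto simp: Ck_on_1 simp del: One_nat_def)
  have 0: "f x = 0" if "x \<notin> ?K" for x
    using that closure_subset[of "{x. f x \<noteq> 0}"] by auto
  show thesis
    using that[OF K 0 grad_eq[OF GDERIV_zero_outside[OF closed_closure 0]] D
        GDERIV_continuous_on[OF D(1)]] by auto
qed

lemma C1_c_mono: "f \<in> C1_c V \<Longrightarrow> V \<subseteq> W \<Longrightarrow> f \<in> C1_c W"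
  by (auto simp: C1_c_def compactly_supported_in_def)

lemma set_integrable_zero_outside_compact:
  fixes f :: "'a::euclidean_space \<Rightarrow> real"
  assumes "continuous_on K f" "compact K" "K \<subseteq> V" "\<And>x. x \<in> V - K \<Longrightarrow> f x = 0"
  shows "set_integrable lborel V f"
proof -
  have "(\<lambda>x. indicator V x *\<^sub>R f x) = (\<lambda>x. indicator K x *\<^sub>R f x)"
    using assms by (auto simp: indicator_def fun_eq_iff)
  then show ?thesis
    unfolding set_integrable_def using borel_integrable_compact[OF assms(2,1)] by simp
qed

text \<open>By translation invariance every difference quotient in direction \<open>b\<close> has
  integral 0, and dominated convergence passes to the derivative. No iterated integration is
  involved and \<open>b\<close> may be any vector.\<close>

lemma integral_directional_derivative_eq_0:
  fixes v :: "'a::euclidean_space \<Rightarrow> real"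
  assumes D: "\<And>x. GDERIV v x :> D x" "continuous_on UNIV (\<lambda>x. D x \<bullet> b)"
    and "compact K" and 0: "\<And>x. x \<notin> K \<Longrightarrow> v x = 0"
  shows "(LINT x|lborel. D x \<bullet> b) = 0"
proof -
  have D0: "D x = 0" if "x \<notin> K" for x
    using GDERIV_zero_outside[of K v, OF compact_imp_closed[OF \<open>compact K\<close>] 0 that] D(1)[of x]
    by (metis grad_eq)
  have "bounded ((\<lambda>x. D x \<bullet> b) ` K)"
    using D(2) \<open>compact K\<close> compact_continuous_image compact_imp_bounded continuous_on_subset subset_UNIV
    by metis
  then obtain M where M: "M > 0" "\<And>x. x \<in> K \<Longrightarrow> \<bar>D x \<bullet> b\<bar> \<le> M"
    unfolding bounded_pos by (auto simp: image_iff)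
  have MU: "\<bar>D x \<bullet> b\<bar> \<le> M" for x
    using M D0[of x] by (cases "x \<in> K") auto
  obtain r where r: "\<And>x. x \<in> K \<Longrightarrow> norm x \<le> r"
    using \<open>compact K\<close> compact_imp_bounded bounded_iff by metis
  define t where "t n = 1 / real (Suc n)" for n
  have t: "0 < t n" "t n \<le> 1" for n
    by (auto simp: t_def)
  have t_lim: "t \<longlonglongrightarrow> 0"
    unfolding t_def using LIMSEQ_inverse_real_of_nat by (simp add: inverse_eq_divide)
  define s where "s n x = (v (x + t n *\<^sub>R b) - v x) / t n" for n x
  have v_cont: "continuous_on UNIV v"
    using D(1) by (rule GDERIV_continuous_on)
  have v_meas: "v \<in> borel_measurable borel"
    using v_cont by (rule borel_measurable_continuous_onI)
  have line: "((\<lambda>a. v (x + a *\<^sub>R b)) has_real_derivative (D (x + a *\<^sub>R b) \<bullet> b)) (at a)" for x a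
  proof -
    have "((\<lambda>a. v (x + a *\<^sub>R b)) has_derivative (\<lambda>h. (h *\<^sub>R b) \<bullet> D (x + a *\<^sub>R b))) (at a)"
      using D(1)[of "x + a *\<^sub>R b"] unfolding gderiv_def
      by (rule has_derivative_compose[rotated]) (auto intro!: derivative_eq_intros)
    then show ?thesis
      unfolding has_field_derivative_def
      by (rule has_derivative_eq_rhs) (auto simp: inner_commute)
  qed
  have v_int: "integrable lborel v"
    using set_integrable_zero_outside_compact[of K v UNIV] \<open>compact K\<close> v_cont 0
    by (auto simp: set_integrable_def intro: continuous_on_subset)
  have v_int': "integrable lborel (\<lambda>x. v (x + c))" "(LINT x|lborel. v (x + c)) = (LINT x|lborel. v x)" for c
  proof -
    have *: "distr lborel borel (\<lambda>x. x + c) = (lborel :: 'a measure)"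
    proof -
      have "(\<lambda>x. x + c) = (+) c"
        by (auto simp: add.commute)
      then show ?thesis
        using lborel_distr_plus[of c] by simp
    qed
    show "integrable lborel (\<lambda>x. v (x + c))"
      using integrable_distr[of "\<lambda>x. x + c" lborel borel v] v_int unfolding * by simp
    show "(LINT x|lborel. v (x + c)) = (LINT x|lborel. v x)"
      using integral_distr[of "\<lambda>x. x + c" lborel borel v] v_meas unfolding * by simp
  qed
  have "(\<lambda>n. LINT x|lborel. s n x) \<longlonglongrightarrow> (LINT x|lborel. D x \<bullet> b)"
  proof (rule integral_dominated_convergence)
    show "(\<lambda>x. D x \<bullet> b) \<in> borel_measurable lborel"
      using borel_measurable_continuous_onI[OF D(2)] by simp
    show "s n \<in> borel_measurable lborel" for n
      unfolding s_def using v_meas by measurable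
    \<comment> \<open>Steps \<open>t n\<close> are at most 1, so this one ball contains the supports
      of all difference quotients; the mean value theorem bounds each of them by
      \<open>M\<close>.\<close>
    show "integrable lborel (\<lambda>x::'a. indicator (cball 0 (r + norm b)) x *\<^sub>R M)"
      by (rule borel_integrable_compact) auto
    show "AE x in lborel. (\<lambda>n. s n x) \<longlonglongrightarrow> D x \<bullet> b"
    proof (rule AE_I2)
      fix x
      have "((\<lambda>h. (v (x + h *\<^sub>R b) - v x) / h) \<longlongrightarrow> D x \<bullet> b) (at 0)"
        using line[of x 0] by (simp add: DERIV_def)
      moreover have "filterlim t (at 0) sequentially"
        using t_lim t by (auto simp: filterlim_at intro!: always_eventually less_imp_neq[symmetric])
      ultimately show "(\<lambda>n. s n x) \<longlonglongrightarrow> D x \<bullet> b"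
        unfolding s_def by (rule filterlim_compose)
    qed
    show "AE x in lborel. norm (s n x) \<le> indicator (cball 0 (r + norm b)) x *\<^sub>R M" for n
    proof (rule AE_I2)
      fix x :: 'a
      show "norm (s n x) \<le> indicator (cball 0 (r + norm b)) x *\<^sub>R M"
      proof (cases "x \<in> cball 0 (r + norm b)")
        case True
        obtain z where "0 < z" "z < t n"
          "v (x + t n *\<^sub>R b) - v (x + 0 *\<^sub>R b) = (t n - 0) * (D (x + z *\<^sub>R b) \<bullet> b)"
          using MVT2[OF t(1)[of n], of "\<lambda>a. v (x + a *\<^sub>R b)" "\<lambda>a. D (x + a *\<^sub>R b) \<bullet> b"] line by blast
        then have "s n x = D (x + z *\<^sub>R b) \<bullet> b"
          using t[of n] by (simp add: s_def)
        then show ?thesis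
          using True MU by simp
      next
        case False
        then have "norm x > r + norm b"
          by simp
        moreover have "norm (t n *\<^sub>R b) \<le> norm b"
          using t[of n] by (simp add: mult_left_le_one_le)
        moreover have "norm x \<le> norm (x + t n *\<^sub>R b) + norm (t n *\<^sub>R b)"
          by (metis add_diff_cancel_right' norm_triangle_ineq4)
        ultimately have "x \<notin> K" "x + t n *\<^sub>R b \<notin> K"
          using r[of x] r[of "x + t n *\<^sub>R b"] norm_ge_zero[of b] by (smt (verit))+
        then show ?thesis
          using 0 M(1) by (simp add: s_def)
      qed
    qed
  qed
  moreover have "(LINT x|lborel. s n x) = 0" for n
    unfolding s_def by (simp add: v_int v_int')
  ultimately show ?thesis
    by (simp add: LIMSEQ_const_iff)
qed

text \<open>The product of \<open>f\<close> and \<phi> is differentiable on the whole space because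
  \<phi> vanishes off a compact subset of \<open>V\<close>, whatever \<open>f\<close> does outside
  \<open>V\<close>; the integral of its derivative along \<open>b\<close> is 0.\<close>

lemma integration_by_parts_C1_c:
  fixes f \<phi> :: "'a::euclidean_space \<Rightarrow> real"
  assumes "open V" "\<phi> \<in> C1_c V"
    and f: "\<And>x. x \<in> V \<Longrightarrow> GDERIV f x :> D x" "continuous_on V (\<lambda>x. D x \<bullet> b)"
  shows "(LINT x:V|lborel. f x * (grad \<phi> x \<bullet> b) + (D x \<bullet> b) * \<phi> x) = 0"
proof -
  obtain K where K: "compact K" "K \<subseteq> V" and 0: "\<And>x. x \<notin> K \<Longrightarrow> \<phi> x = 0" "\<And>x. x \<notin> K \<Longrightarrow> grad \<phi> x = 0"
    and \<phi>: "\<And>x. GDERIV \<phi> x :> grad \<phi> x" "continuous_on UNIV (grad \<phi>)" "continuous_on UNIV \<phi>"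
    using C1_cE[OF \<open>\<phi> \<in> C1_c V\<close>] by metis
  have "closed K"
    using K(1) by (rule compact_imp_closed)
  define E where "E x = (if x \<in> V then f x *\<^sub>R grad \<phi> x + \<phi> x *\<^sub>R D x else 0)" for x
  have E0: "E x = 0" if "x \<notin> K" for x
    using 0 that by (simp add: E_def)
  have "GDERIV (\<lambda>x. f x * \<phi> x) x :> E x" for x
  proof (cases "x \<in> V")
    case True
    then show ?thesis
      using GDERIV_mult[OF f(1) \<phi>(1)] by (simp add: E_def add.commute)
  next
    case False
    then show ?thesis
      using GDERIV_zero_outside[of K "\<lambda>x. f x * \<phi> x", OF \<open>closed K\<close>] 0 E0 K(2) by (metis mult_zero_right subsetD)
  qed
  moreover have "continuous_on UNIV (\<lambda>x. E x \<bullet> b)"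
  proof (rule continuous_on_zero_outside[of V _ K])
    have "continuous_on V (\<lambda>x. f x * (grad \<phi> x \<bullet> b) + \<phi> x * (D x \<bullet> b))"
      by (intro continuous_intros f(2) GDERIV_continuous_on[OF f(1)] continuous_on_subset[OF \<phi>(2)]
          continuous_on_subset[OF \<phi>(3)]) auto
    then show "continuous_on V (\<lambda>x. E x \<bullet> b)"
      by (rule continuous_on_eq) (simp add: E_def inner_add_left)
  qed (use assms \<open>closed K\<close> K E0 in auto)
  ultimately have "(LINT x|lborel. E x \<bullet> b) = 0"
    using K(1) 0 by (intro integral_directional_derivative_eq_0[of "\<lambda>x. f x * \<phi> x" _ b K]) auto
  moreover have "E x \<bullet> b = indicator V x *\<^sub>R (f x * (grad \<phi> x \<bullet> b) + (D x \<bullet> b) * \<phi> x)" for x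
    by (simp add: E_def inner_add_left mult.commute)
  ultimately show ?thesis
    by (simp add: set_lebesgue_integral_def)
qed

text \<open>Integration by parts, summed over the components of \<open>W\<close>. Only the diagonal
  entries of the derivative occur, so only these have to be continuous; in the application
  \<open>W\<close> is the gradient of a barrier and the sum is its Laplacian.\<close>

lemma integral_divergence_C1_c:
  fixes W :: "'a::euclidean_space \<Rightarrow> 'a"
  assumes "open V" "\<phi> \<in> C1_c V"
    and W: "\<And>x. x \<in> V \<Longrightarrow> (W has_derivative W' x) (at x)"
    and W': "\<And>b. b \<in> Basis \<Longrightarrow> continuous_on V (\<lambda>x. W' x b \<bullet> b)"
  shows "(LINT x:V|lborel. W x \<bullet> grad \<phi> x + (\<Sum>b\<in>Basis. W' x b \<bullet> b) * \<phi> x) = 0"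
proof -
  obtain K where K: "compact K" "K \<subseteq> V" and 0: "\<And>x. x \<notin> K \<Longrightarrow> \<phi> x = 0" "\<And>x. x \<notin> K \<Longrightarrow> grad \<phi> x = 0"
    and \<phi>: "continuous_on UNIV (grad \<phi>)" "continuous_on UNIV \<phi>"
    using C1_cE[OF \<open>\<phi> \<in> C1_c V\<close>] by metis
  have cW: "continuous_on V W"
    using W has_derivative_continuous continuous_at_imp_continuous_on by blast
  have comp: "(LINT x:V|lborel. (W x \<bullet> b) * (grad \<phi> x \<bullet> b) + (W' x b \<bullet> b) * \<phi> x) = 0"
    and int: "set_integrable lborel V (\<lambda>x. (W x \<bullet> b) * (grad \<phi> x \<bullet> b) + (W' x b \<bullet> b) * \<phi> x)"
    if b: "b \<in> Basis" for b
  proof -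
    have d: "GDERIV (\<lambda>x. W x \<bullet> b) x :> grad (\<lambda>x. W x \<bullet> b) x" and d': "grad (\<lambda>x. W x \<bullet> b) x \<bullet> b = W' x b \<bullet> b"
      if "x \<in> V" for x
    proof -
      have *: "((\<lambda>x. W x \<bullet> b) has_derivative (\<lambda>h. W' x h \<bullet> b)) (at x)"
        using W[OF that] by (rule has_derivative_inner_left)
      then show **: "GDERIV (\<lambda>x. W x \<bullet> b) x :> grad (\<lambda>x. W x \<bullet> b) x"
        by (intro GDERIV_grad) (auto simp: differentiable_def)
      show "grad (\<lambda>x. W x \<bullet> b) x \<bullet> b = W' x b \<bullet> b"
        using has_derivative_unique[OF * **[unfolded gderiv_def]] by (metis inner_commute)
    qed
    have c: "continuous_on V (\<lambda>x. grad (\<lambda>x. W x \<bullet> b) x \<bullet> b)"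
      using W'[OF b] by (rule continuous_on_eq) (simp add: d')
    have "(LINT x:V|lborel. (W x \<bullet> b) * (grad \<phi> x \<bullet> b) + (grad (\<lambda>x. W x \<bullet> b) x \<bullet> b) * \<phi> x) = 0"
      using integration_by_parts_C1_c[OF assms(1,2) d c] .
    then show "(LINT x:V|lborel. (W x \<bullet> b) * (grad \<phi> x \<bullet> b) + (W' x b \<bullet> b) * \<phi> x) = 0"
      using \<open>open V\<close> by (subst set_lebesgue_integral_cong) (auto simp: d')
    show "set_integrable lborel V (\<lambda>x. (W x \<bullet> b) * (grad \<phi> x \<bullet> b) + (W' x b \<bullet> b) * \<phi> x)"
      using K 0 by (intro set_integrable_zero_outside_compact[of K] continuous_intros
          continuous_on_subset[OF cW] continuous_on_subset[OF \<phi>(1)] continuous_on_subset[OF \<phi>(2)]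
          continuous_on_subset[OF W'[OF b]]) auto
  qed
  have "(LINT x:V|lborel. W x \<bullet> grad \<phi> x + (\<Sum>b\<in>Basis. W' x b \<bullet> b) * \<phi> x)
      = (LINT x:V|lborel. (\<Sum>b\<in>Basis. (W x \<bullet> b) * (grad \<phi> x \<bullet> b) + (W' x b \<bullet> b) * \<phi> x))"
    by (simp only: euclidean_inner[of "W x" "grad \<phi> x" for x] sum.distrib sum_distrib_right)
  also have "\<dots> = (\<Sum>b\<in>Basis. LINT x:V|lborel. (W x \<bullet> b) * (grad \<phi> x \<bullet> b) + (W' x b \<bullet> b) * \<phi> x)"
    using int unfolding set_lebesgue_integral_def set_integrable_def scaleR_sum_right
    by (rule Bochner_Integration.integral_sum)
  finally show ?thesis
    using comp by simp
qed

text \<open>The set where \<open>f\<close> is positive is open and null, and a nonempty open set is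
  not negligible.\<close>

lemma set_integral_nonneg_eq_0:
  fixes f :: "'a::euclidean_space \<Rightarrow> real"
  assumes "open S" "continuous_on S f" "\<And>x. x \<in> S \<Longrightarrow> 0 \<le> f x"
    and "set_integrable lborel S f" "(LINT x:S|lborel. f x) \<le> 0" "x \<in> S"
  shows "f x = 0"
proof (rule ccontr)
  assume "f x \<noteq> 0"
  let ?U = "{x \<in> S. f x \<in> {0<..}}"
  have "open ?U"
    using continuous_open_preimage[OF assms(2,1), of "{0<..}"] by (simp add: vimage_def Int_def)
  have "(LINT x|lborel. indicator S x *\<^sub>R f x) = 0"
    using assms(5) by (intro antisym Bochner_Integration.integral_nonneg)
      (auto simp: set_lebesgue_integral_def indicator_def assms(3))
  then have "AE x in lborel. indicator S x *\<^sub>R f x = 0"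
    using assms(3,4) by (subst (asm) integral_nonneg_eq_0_iff_AE)
      (auto simp: set_integrable_def indicator_def)
  then have "AE x in lborel. x \<notin> ?U"
    by eventually_elim auto
  then have "?U \<in> null_sets lborel"
    using \<open>open ?U\<close> by (simp add: AE_iff_null_sets)
  then have "negligible ?U"
    by (meson negligible_iff_null_sets null_sets_completionI)
  moreover have "x \<in> ?U"
    using assms(3,6) \<open>f x \<noteq> 0\<close> by (simp add: less_le)
  ultimately show False
    using open_not_negligible[OF \<open>open ?U\<close>] by blast
qed

section \<open>Touching a weak solution from above\<close>

lemma set_integral_restrict:
  fixes f :: "'a \<Rightarrow> real"
  assumes "U \<subseteq> V" "\<And>x. x \<in> V - U \<Longrightarrow> f x = 0"
  shows "(LINT x:V|M. f x) = (LINT x:U|M. f x)"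
  unfolding set_lebesgue_integral_def
  by (rule Bochner_Integration.integral_cong) (use assms in \<open>auto simp: indicator_def\<close>)

text \<open>Squaring makes the positive part continuously differentiable across 0, as membership in
  \<open>C1_c\<close> demands.\<close>

lemma DERIV_positive_part_square:
  "((\<lambda>s::real. (max 0 s)\<^sup>2) has_real_derivative 2 * max 0 s) (at s)"
proof (cases s "0::real" rule: linorder_cases)
  case less
  have "((\<lambda>s::real. 0) has_real_derivative 2 * max 0 s) (at s)"
    using less by simp
  then show ?thesis
    by (rule has_field_derivative_transform_within_open[where S = "{..<0}"]) (use less in auto)
next
  case greater
  have "((\<lambda>s::real. s\<^sup>2) has_real_derivative 2 * max 0 s) (at s)"
    using greater by (auto intro!: derivative_eq_intros)
  then show ?thesis
    by (rule has_field_derivative_transform_within_open[where S = "{0<..}"]) (use greater in auto)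
next
  case equal
  have "((\<lambda>h::real. (max 0 h)\<^sup>2 / h) \<longlongrightarrow> 0) (at 0)"
  proof (rule Lim_null_comparison)
    show "\<forall>\<^sub>F h in at 0. norm ((max 0 h)\<^sup>2 / h) \<le> \<bar>h\<bar>" for h :: real
      by (rule always_eventually) (auto simp: max_def power2_eq_square)
    show "((\<lambda>h::real. \<bar>h\<bar>) \<longlongrightarrow> 0) (at 0)"
      by (rule tendsto_rabs_zero) (rule tendsto_ident_at)
  qed
  then show ?thesis
    using equal by (simp add: DERIV_def)
qed

text \<open>The test function is the square of the positive part of \<open>u - w\<close>, lowered by a small paraboloid
  and shifted so that its support shrinks to \<open>y\<close>.\<close>

lemma weak_solution_touching:
  fixes u w :: "'a::euclidean_space \<Rightarrow> real"
  assumes V: "open V"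
    and u: "\<And>x. x \<in> V \<Longrightarrow> GDERIV u x :> Du x" "continuous_on V Du"
    and B: "continuous_on V B"
    and weak: "\<And>\<phi>. \<phi> \<in> C1_c V \<Longrightarrow> (LINT x:V|lborel. B x * \<phi> x - Du x \<bullet> grad \<phi> x) = 0"
    and S: "open S" "S \<subseteq> V" "y \<in> S"
    and w: "\<And>x. x \<in> S \<Longrightarrow> GDERIV w x :> W x"
      "\<And>x. x \<in> S \<Longrightarrow> (W has_derivative W' x) (at x)"
      "\<And>b. b \<in> Basis \<Longrightarrow> continuous_on S (\<lambda>x. W' x b \<bullet> b)"
    and max: "\<And>x. x \<in> S \<Longrightarrow> u x - w x \<le> u y - w y"
  shows "0 \<le> (\<Sum>b\<in>Basis. W' y b \<bullet> b) + B y"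
proof (rule ccontr)
  let ?N = "real DIM('a)"
  let ?div = "\<lambda>x. \<Sum>b\<in>Basis. W' x b \<bullet> b"
  assume "\<not> ?thesis"
  then have neg: "?div y + B y < 0"
    by simp
  \<comment> \<open>The paraboloid with coefficient \<kappa> has Laplacian
    \<open>2 * ?N * \<kappa>\<close>, which is half of the deficit at \<open>y\<close>. Hence
    \<open>F y\<close> is still negative, namely half of the original value.\<close>
  define \<kappa> where "\<kappa> = - (?div y + B y) / (4 * ?N)"
  have \<kappa>: "\<kappa> > 0"
    using neg by (simp add: \<kappa>_def divide_neg_pos)
  define F where "F x = ?div x + 2 * ?N * \<kappa> + B x" for x
  have Fy: "F y < 0"
  proof -
    have "2 * ?N * \<kappa> = - (?div y + B y) / 2"
      by (simp add: \<kappa>_def)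
    then have "F y = ?div y + - (?div y + B y) / 2 + B y"
      unfolding F_def by presburger
    then show ?thesis
      using neg by (simp add: field_simps)
  qed
  have cF: "continuous_on S F"
    unfolding F_def
    by (intro continuous_on_add continuous_on_sum continuous_on_const w(3) continuous_on_subset[OF B S(2)])
  have "open {x \<in> S. F x \<in> {..<0}}"
    using continuous_open_preimage[OF cF S(1), of "{..<0}"] by (simp add: vimage_def Int_def)
  then obtain \<delta> where \<delta>: "\<delta> > 0" "ball y \<delta> \<subseteq> {x \<in> S. F x \<in> {..<0}}"
    using Fy S(3) open_contains_ball[of "{x \<in> S. F x \<in> {..<0}}"] by auto
  define U where "U = ball y \<delta>"
  have U: "open U" "U \<subseteq> S" "y \<in> U" "U \<subseteq> V" and FU: "\<And>x. x \<in> U \<Longrightarrow> F x < 0"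
    using \<delta> S(2) by (auto simp: U_def)
  \<comment> \<open>The last constant makes \<open>h y\<close> positive, while maximality at
    \<open>y\<close> makes \<open>h\<close> negative as soon as |x - y|^2 exceeds half of
    \<delta>^2. Since 9/16 > 1/2, the positive part lives in the ball of radius 3/4
    \<delta>.\<close>
  define h where "h x = u x - w x - \<kappa> * ((x - y) \<bullet> (x - y)) - (u y - w y) + \<kappa> * \<delta>\<^sup>2 / 2" for x
  define Z where "Z x = W x + (2 * \<kappa>) *\<^sub>R (x - y)" for x
  have h: "GDERIV h x :> Du x - Z x" if "x \<in> U" for x
  proof -
    have "((\<lambda>x. (x - y) \<bullet> (x - y)) has_derivative (\<lambda>h. h \<bullet> (2 *\<^sub>R (x - y)))) (at x)"
      by (auto intro!: derivative_eq_intros simp: inner_commute)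
    then have "GDERIV (\<lambda>x. \<kappa> * ((x - y) \<bullet> (x - y))) x :> (2 * \<kappa>) *\<^sub>R (x - y)"
      unfolding gderiv_def
      by (rule has_derivative_eq_rhs[OF has_derivative_mult_right]) (auto simp: fun_eq_iff)
    then have "GDERIV (\<lambda>x. u x - w x - \<kappa> * ((x - y) \<bullet> (x - y))) x :> Du x - W x - (2 * \<kappa>) *\<^sub>R (x - y)"
      using that U by (intro GDERIV_diff u(1) w(1)) auto
    then have "GDERIV (\<lambda>x. (u x - w x - \<kappa> * ((x - y) \<bullet> (x - y))) + (- (u y - w y) + \<kappa> * \<delta>\<^sup>2 / 2)) x
        :> (Du x - W x - (2 * \<kappa>) *\<^sub>R (x - y)) + 0"
      by (intro GDERIV_add GDERIV_const)
    then show ?thesis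
      unfolding h_def Z_def by (simp add: algebra_simps)
  qed
  define \<phi> where "\<phi> x = (if x \<in> U then (max 0 (h x))\<^sup>2 else 0)" for x
  have \<phi>: "GDERIV \<phi> x :> (2 * max 0 (h x)) *\<^sub>R (Du x - Z x)" if "x \<in> U" for x
    using GDERIV_transform_open[OF GDERIV_DERIV_compose[OF h[OF that] DERIV_positive_part_square] U(1) that]
    by (simp add: \<phi>_def)
  have cDu: "continuous_on U Du" and cB: "continuous_on U B"
    using u(2) B U continuous_on_subset by blast+
  have cW: "continuous_on U W"
    using w(2) U has_derivative_continuous continuous_at_imp_continuous_on by (metis subsetD)
  have cZ: "continuous_on U Z"
    unfolding Z_def by (intro continuous_intros cW)
  have ch: "continuous_on U h"
    using h by (rule GDERIV_continuous_on)
  have hpos: "h x < 0" if "x \<in> U" "x \<notin> cball y (3/4 * \<delta>)" for x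
  proof -
    have "3/4 * \<delta> < norm (x - y)"
      using that by (simp add: dist_norm norm_minus_commute)
    then have "(3/4 * \<delta>)\<^sup>2 < (norm (x - y))\<^sup>2"
      using \<delta>(1) by (intro power_strict_mono) auto
    moreover have "\<delta>\<^sup>2 > 0"
      using \<delta>(1) by simp
    moreover have "(3/4 * \<delta>)\<^sup>2 = 9/16 * \<delta>\<^sup>2"
      by (simp add: power2_eq_square)
    ultimately have "\<delta>\<^sup>2 / 2 < (norm (x - y))\<^sup>2"
      by linarith
    then have "\<kappa> * (\<delta>\<^sup>2 / 2) < \<kappa> * (norm (x - y))\<^sup>2"
      using \<kappa> by simp
    then show ?thesis
      using max[of x] that U by (auto simp: h_def power2_norm_eq_inner)
  qed
  have \<phi>U: "\<phi> \<in> C1_c U"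
  proof (rule C1_cI[OF U(1) _ _ \<phi>])
    show "compact (cball y (3/4 * \<delta>))" "cball y (3/4 * \<delta>) \<subseteq> U"
      using \<delta>(1) by (auto simp: U_def)
    show "\<phi> x = 0" if "x \<notin> cball y (3/4 * \<delta>)" for x
      using hpos[OF _ that] by (auto simp: \<phi>_def max_def)
    show "continuous_on U (\<lambda>x. (2 * max 0 (h x)) *\<^sub>R (Du x - Z x))"
      by (intro continuous_intros ch cDu cZ)
  qed
  obtain K where K: "compact K" "K \<subseteq> U" and 0: "\<And>x. x \<notin> K \<Longrightarrow> \<phi> x = 0" "\<And>x. x \<notin> K \<Longrightarrow> grad \<phi> x = 0"
    and c\<phi>: "continuous_on UNIV (grad \<phi>)" "continuous_on UNIV \<phi>"
    using C1_cE[OF \<phi>U] by metis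
  have grad\<phi>: "grad \<phi> x = (2 * max 0 (h x)) *\<^sub>R (Du x - Z x)" if "x \<in> U" for x
    using grad_eq[OF \<phi>[OF that]] .
  let ?f = "\<lambda>x. B x * \<phi> x - Du x \<bullet> grad \<phi> x"
  let ?Z' = "\<lambda>x v. W' x v + (2 * \<kappa>) *\<^sub>R v"
  let ?g = "\<lambda>x. Z x \<bullet> grad \<phi> x + (\<Sum>b\<in>Basis. ?Z' x b \<bullet> b) * \<phi> x"
  have cW': "continuous_on U (\<lambda>x. W' x b \<bullet> b)" if "b \<in> Basis" for b
    using w(3)[OF that] U(2) continuous_on_subset by blast
  have cZ': "continuous_on U (\<lambda>x. ?Z' x b \<bullet> b)" if "b \<in> Basis" for b
    unfolding inner_add_left by (intro continuous_intros cW' that)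
  have c\<phi>U: "continuous_on U (grad \<phi>)" "continuous_on U \<phi>"
    using c\<phi> continuous_on_subset by blast+
  have cf: "continuous_on U ?f" and cg: "continuous_on U ?g"
    by (intro continuous_on_add continuous_on_diff continuous_on_mult continuous_on_inner
        continuous_on_sum cZ' cB cDu cZ c\<phi>U; assumption)+
  have int: "set_integrable lborel U ?f" "set_integrable lborel U ?g"
    by (rule set_integrable_zero_outside_compact[OF continuous_on_subset[OF cf K(2)] K]
        set_integrable_zero_outside_compact[OF continuous_on_subset[OF cg K(2)] K]; simp add: 0)+
  have "(LINT x:U|lborel. ?f x) = 0"
    using weak[OF C1_c_mono[OF \<phi>U U(4)]] set_integral_restrict[OF U(4), of ?f lborel] 0 K(2)
    by (metis (no_types, lifting) DiffE inner_zero_right mult_zero_right subsetD diff_self)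
  moreover have "(LINT x:U|lborel. ?g x) = 0"
  proof (rule integral_divergence_C1_c[OF U(1) \<phi>U _ cZ'])
    show "(Z has_derivative ?Z' x) (at x)" if "x \<in> U" for x
      unfolding Z_def using w(2)[of x] U(2) that by (auto intro!: derivative_eq_intros)
  qed
  ultimately have "(LINT x:U|lborel. ?f x + ?g x) = 0"
    using int by simp
  then have int0: "(LINT x:U|lborel. - (?f x + ?g x)) \<le> 0"
    using set_integral_uminus[OF set_integral_add(1)[OF int]] by simp
  \<comment> \<open>Adding the weak equation and the divergence identity for \<open>Z\<close> leaves
    (Du - Z) . grad \<phi>, and grad \<phi> is itself a nonnegative multiple of Du - Z. Both terms
    on the right are therefore nonnegative on \<open>U\<close>, and the first is positive at
    \<open>y\<close>, although the integral is 0.\<close>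
  have sum: "- (?f x + ?g x) = - F x * \<phi> x + 2 * max 0 (h x) * ((Du x - Z x) \<bullet> (Du x - Z x))" if "x \<in> U" for x
  proof -
    have "(\<Sum>b\<in>Basis. ?Z' x b \<bullet> b) = ?div x + 2 * ?N * \<kappa>"
      by (simp add: inner_add_left sum.distrib inner_same_Basis)
    then show ?thesis
      by (simp add: grad\<phi>[OF that] F_def algebra_simps inner_diff_right)
  qed
  have nonneg: "- (?f x + ?g x) \<ge> 0" if "x \<in> U" for x
    unfolding sum[OF that] using FU[OF that]
    by (intro add_nonneg_nonneg mult_nonneg_nonneg) (auto simp: \<phi>_def)
  have "- (?f y + ?g y) = 0"
  proof (rule set_integral_nonneg_eq_0[OF U(1) _ nonneg _ int0 U(3)])
    show "continuous_on U (\<lambda>x. - (?f x + ?g x))"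
      by (intro continuous_on_minus continuous_on_add cf cg)
    show "set_integrable lborel U (\<lambda>x. - (?f x + ?g x))"
      using set_integral_add(1)[OF int] unfolding set_integrable_def scaleR_minus_right
      by (rule Bochner_Integration.integrable_minus)
  qed
  moreover have hy: "h y > 0"
    using \<kappa> \<delta>(1) by (simp add: h_def)
  then have "- F y * \<phi> y > 0"
    using Fy U(3) by (simp add: \<phi>_def mult_neg_pos)
  then have "- (?f y + ?g y) > 0"
    unfolding sum[OF U(3)] using hy by (intro add_pos_nonneg mult_nonneg_nonneg) auto
  ultimately show False
    by linarith
qed

subsection \<open>The Keller--Osserman bound\<close>

text \<open>A crude Young inequality: both factors are replaced by powers of the maximum, and the
  exponents add up to 1.\<close>

lemma powr_mult_powr_le_add:
  fixes a b s :: real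
  assumes "0 \<le> a" "0 \<le> b" "0 \<le> s" "s \<le> 1"
  shows "a powr s * b powr (1 - s) \<le> a + b"
proof -
  let ?m = "max a b"
  have "a powr s * b powr (1 - s) \<le> ?m powr s * ?m powr (1 - s)"
    using assms by (intro mult_mono powr_mono2) auto
  also have "\<dots> = ?m"
    using assms by (simp add: powr_add[symmetric])
  also have "\<dots> \<le> a + b"
    using assms by simp
  finally show ?thesis .
qed

lemma G_nonneg: "0 \<le> G \<tau> x z \<xi>"
  by (simp add: G_def)

text \<open>For positive \<tau>, \<open>G\<close> is a weighted geometric mean of
  \<open>z / norm x\<close> and \<open>norm \<xi>\<close>, divided by \<open>norm x\<close>. This
  linear bound puts the term on the same scale as the drift, after which the exponent \<tau> no
  longer matters.\<close>

lemma G_le: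
  assumes "0 \<le> \<tau>" "\<tau> < 1" "0 \<le> z" "x \<noteq> 0"
  shows "G \<tau> x z \<xi> \<le> (z / norm x + norm \<xi>) / norm x"
proof (cases "\<tau> = 0")
  case True
  then show ?thesis
    using assms by (simp add: G_def divide_right_mono)
next
  case False
  have "G \<tau> x z \<xi> = ((z / norm x) powr \<tau> * norm \<xi> powr (1 - \<tau>)) / norm x"
    using assms False by (simp add: G_def powr_divide powr_add)
  also have "\<dots> \<le> (z / norm x + norm \<xi>) / norm x"
    using assms by (intro divide_right_mono powr_mult_powr_le_add) auto
  finally show ?thesis .
qed

lemma abs_drift_le:
  fixes u :: "'a::euclidean_space \<Rightarrow> real"
  shows "\<bar>drift \<rho> u x\<bar> \<le> \<bar>real DIM('a) - 2 + 2 * \<rho>\<bar> * (norm (grad u x) / norm x)"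
proof (cases "x = 0")
  case False
  have "\<bar>x \<bullet> grad u x\<bar> / (norm x)\<^sup>2 \<le> norm x * norm (grad u x) / (norm x)\<^sup>2"
    by (intro divide_right_mono Cauchy_Schwarz_ineq2) auto
  also have "\<dots> = norm (grad u x) / norm x"
    using False by (simp add: power2_eq_square)
  finally show ?thesis
    unfolding drift_def abs_mult[of "real DIM('a) - 2 + 2 * \<rho>"] by (intro mult_left_mono) auto
qed (simp add: drift_def)

section \<open>The barrier on a ball\<close>

lemma ball_weight_pos:
  assumes "x \<in> ball x\<^sub>0 R"
  shows "0 < 1 - ((x - x\<^sub>0) \<bullet> (x - x\<^sub>0)) / R\<^sup>2"
proof -
  have "norm (x - x\<^sub>0) < R" "0 < R"
    using assms by (auto simp: dist_norm norm_minus_commute intro: le_less_trans[OF norm_ge_zero])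
  then have "(norm (x - x\<^sub>0))\<^sup>2 < R\<^sup>2"
    by (intro power_strict_mono) auto
  then show ?thesis
    using \<open>0 < R\<close> by (simp add: power2_norm_eq_inner)
qed

lemma ball_weight_has_derivative:
  "((\<lambda>x. 1 - ((x - x\<^sub>0) \<bullet> (x - x\<^sub>0)) / R\<^sup>2) has_derivative (\<lambda>h. - (2 / R\<^sup>2) * (h \<bullet> (x - x\<^sub>0)))) (at x)"
proof -
  have "((\<lambda>x. (x - x\<^sub>0) \<bullet> (x - x\<^sub>0)) has_derivative (\<lambda>h. 2 * (h \<bullet> (x - x\<^sub>0)))) (at x)"
    by (auto intro!: derivative_eq_intros simp: inner_commute)
  from has_derivative_diff[OF has_derivative_const has_derivative_mult_right[OF this, of "inverse (R\<^sup>2)"], of 1]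
  show ?thesis
    by (simp add: divide_inverse algebra_simps)
qed

text \<open>Stated for a general exponent because it is applied twice: with
  \<open>a = \<alpha>\<close> it gives the gradient of the barrier, with
  \<open>a = \<alpha> + 1\<close> the derivative of that gradient.\<close>

lemma ball_weight_powr_has_derivative:
  assumes "x \<in> ball x\<^sub>0 R"
  defines "d \<equiv> \<lambda>x. 1 - ((x - x\<^sub>0) \<bullet> (x - x\<^sub>0)) / R\<^sup>2"
  shows "((\<lambda>x. d x powr (- a)) has_derivative
    (\<lambda>h. (2 * a / R\<^sup>2) * d x powr (- a - 1) * (h \<bullet> (x - x\<^sub>0)))) (at x)"
proof -
  have "((\<lambda>s. s powr (- a)) has_real_derivative - a * d x powr (- a - 1)) (at (d x))"
    using ball_weight_pos[OF assms(1)] by (intro has_real_derivative_powr) (simp add: d_def)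
  then have "((\<lambda>x. d x powr (- a)) has_derivative
    (\<lambda>h. (- a * d x powr (- a - 1)) * (- (2 / R\<^sup>2) * (h \<bullet> (x - x\<^sub>0))))) (at x)"
    unfolding has_field_derivative_def d_def
    by (rule has_derivative_compose[OF ball_weight_has_derivative])
  then show ?thesis
    by (rule has_derivative_eq_rhs) (auto simp: fun_eq_iff)
qed

section \<open>The solution on the punctured domain\<close>

locale positive_solution_near_0 =
  fixes \<Omega> :: "'a::euclidean_space set" and u :: "'a \<Rightarrow> real" and q \<tau> \<rho> lam \<theta> :: real
  assumes dim: "DIM('a) \<ge> 2" and q: "q > 1" and \<tau>: "0 \<le> \<tau>" "\<tau> < 1" and \<theta>: "\<theta> < -2"
    and \<Omega>: "open \<Omega>" "0 \<in> \<Omega>" and sol: "positive_solution \<rho> lam \<tau> \<theta> q \<Omega> u"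
begin

text \<open>Everything except the Laplacian, moved to one side: the equation becomes Delta u +
  \<open>rhs\<close> = 0, a Poisson equation whose source is continuous away from the
  origin.\<close>

definition rhs :: "'a \<Rightarrow> real" where
  "rhs x = lam * G \<tau> x (u x) (grad u x) - drift \<rho> u x - norm x powr \<theta> * u x powr q"

lemma open_punctured: "open (\<Omega> - {0})"
  using \<Omega> by auto

lemma u_pos: "x \<in> \<Omega> - {0} \<Longrightarrow> 0 < u x"
  using sol by (auto simp: positive_solution_def)

lemma u_GDERIV: "x \<in> \<Omega> - {0} \<Longrightarrow> GDERIV u x :> grad u x"
  and continuous_grad: "continuous_on (\<Omega> - {0}) (grad u)"
  using sol unfolding positive_solution_def Ck_on_1 by auto

lemma continuous_u: "continuous_on (\<Omega> - {0}) u"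
  using u_GDERIV by (rule GDERIV_continuous_on)

text \<open>Critical points of \<open>u\<close> are harmless because the exponent 1 - \<tau> is
  positive; the power of \<open>u\<close> is harmless because \<open>u\<close> is positive.\<close>

lemma continuous_G: "continuous_on (\<Omega> - {0}) (\<lambda>x. G \<tau> x (u x) (grad u x))"
proof (cases "\<tau> = 0")
  case True
  then show ?thesis
    unfolding G_def by (auto intro!: continuous_intros continuous_grad)
next
  case False
  have "continuous_on (\<Omega> - {0}) (\<lambda>x. u x powr \<tau> * norm (grad u x) powr (1 - \<tau>) / norm x powr (\<tau> + 1))"
    using \<tau> by (intro continuous_on_divide continuous_on_mult continuous_on_powr' continuous_on_norm
        continuous_u continuous_grad continuous_on_const continuous_on_id)
      (use False in \<open>auto intro: less_imp_le u_pos dest: u_pos[THEN less_imp_neq]\<close>)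
  then show ?thesis
    using False by (simp add: G_def)
qed

lemma continuous_drift: "continuous_on (\<Omega> - {0}) (drift \<rho> u)"
  unfolding drift_def by (intro continuous_intros continuous_grad) auto

lemma continuous_absorption: "continuous_on (\<Omega> - {0}) (\<lambda>x. norm x powr \<theta> * u x powr q)"
  by (intro continuous_on_mult continuous_on_powr continuous_u continuous_on_const continuous_on_norm
        continuous_on_id) (use u_pos in force)+

lemma continuous_rhs: "continuous_on (\<Omega> - {0}) rhs"
  unfolding rhs_def by (intro continuous_intros continuous_G continuous_drift continuous_absorption)

lemma weak_form:
  assumes "\<phi> \<in> C1_c (\<Omega> - {0})"
  shows "(LINT x:\<Omega> - {0}|lborel. rhs x * \<phi> x - grad u x \<bullet> grad \<phi> x) = 0"
proof -
  obtain K where K: "compact K" "K \<subseteq> \<Omega> - {0}" and 0: "\<And>x. x \<notin> K \<Longrightarrow> \<phi> x = 0" "\<And>x. x \<notin> K \<Longrightarrow> grad \<phi> x = 0"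
    and c: "continuous_on UNIV (grad \<phi>)" "continuous_on UNIV \<phi>"
    using C1_cE[OF assms] by metis
  let ?f = "\<lambda>x. - (grad u x \<bullet> grad \<phi> x) - drift \<rho> u x * \<phi> x + lam * G \<tau> x (u x) (grad u x) * \<phi> x"
  let ?g = "\<lambda>x. norm x powr \<theta> * u x powr q * \<phi> x"
  have "continuous_on (\<Omega> - {0}) ?f" "continuous_on (\<Omega> - {0}) ?g"
    by (intro continuous_on_add continuous_on_diff continuous_on_minus continuous_on_mult continuous_on_inner
        continuous_on_const continuous_G continuous_drift continuous_absorption continuous_grad
        continuous_on_subset[OF c(1)] continuous_on_subset[OF c(2)] subset_UNIV)+
  then have "set_integrable lborel (\<Omega> - {0}) ?f" "set_integrable lborel (\<Omega> - {0}) ?g"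
    using K 0 by (auto intro!: set_integrable_zero_outside_compact[of K] intro: continuous_on_subset)
  moreover have "(LINT x:\<Omega> - {0}|lborel. ?f x) = (LINT x:\<Omega> - {0}|lborel. ?g x)"
    using sol assms unfolding positive_solution_def L_equation_C1_def by blast
  ultimately have "(LINT x:\<Omega> - {0}|lborel. ?f x - ?g x) = 0"
    by simp
  moreover have "(\<lambda>x. ?f x - ?g x) = (\<lambda>x. rhs x * \<phi> x - grad u x \<bullet> grad \<phi> x)"
    by (auto simp: rhs_def algebra_simps)
  ultimately show ?thesis
    by simp
qed

text \<open>A substitute for the pointwise inequality Delta u <= Delta w at a maximum of u - w,
  which makes no sense for a C^1 function. The equality of gradients lets \<open>rhs y\<close> be
  estimated through the barrier alone.\<close>

lemma touching_from_above:
  assumes S: "open S" "S \<subseteq> \<Omega> - {0}" "y \<in> S"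
    and w: "\<And>x. x \<in> S \<Longrightarrow> GDERIV w x :> W x"
      "\<And>x. x \<in> S \<Longrightarrow> (W has_derivative W' x) (at x)"
      "\<And>b. b \<in> Basis \<Longrightarrow> continuous_on S (\<lambda>x. W' x b \<bullet> b)"
    and max: "\<And>x. x \<in> S \<Longrightarrow> u x - w x \<le> u y - w y"
  shows "grad u y = W y" and "0 \<le> (\<Sum>b\<in>Basis. W' y b \<bullet> b) + rhs y"
proof -
  have "GDERIV (\<lambda>x. u x - w x) y :> grad u y - W y"
    using S by (intro GDERIV_diff u_GDERIV w(1)) auto
  then have "(\<lambda>h. h \<bullet> (grad u y - W y)) = (\<lambda>h. 0)"
    unfolding gderiv_def
    using differential_zero_maxmin[OF S(3,1)] max by blast
  then show "grad u y = W y"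
    by (metis inner_eq_zero_iff eq_iff_diff_eq_0)
  show "0 \<le> (\<Sum>b\<in>Basis. W' y b \<bullet> b) + rhs y"
    by (rule weak_solution_touching[OF open_punctured u_GDERIV continuous_grad continuous_rhs weak_form S w max])
qed

text \<open>At a maximum point of \<open>u d\<^sup>\<alpha>\<close>, where \<open>d = 1 - \<bar>x - x\<^sub>0\<bar>\<^sup>2 / R\<^sup>2\<close>, the multiple
  \<open>t d powr - \<alpha>\<close> of the large-solution barrier touches \<open>u\<close> from above.\<close>

lemma Keller_Osserman:
  obtains C where "C > 0"
    "\<And>x. x \<noteq> 0 \<Longrightarrow> cball x (norm x / 2) \<subseteq> \<Omega> \<Longrightarrow> norm x powr \<theta> * u x powr (q - 1) \<le> C / (norm x)\<^sup>2"
proof -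
  let ?N = "real DIM('a)"
  let ?c = "\<bar>?N - 2 + 2 * \<rho>\<bar>"
  \<comment> \<open>With this exponent the power \<open>q\<close> of the barrier and its second
    derivatives blow up at the same rate, the power - \<alpha> - 2 of \<open>d\<close>.\<close>
  define \<alpha> where "\<alpha> = 2 / (q - 1)"
  have \<alpha>: "\<alpha> > 0" "\<alpha> * q = \<alpha> + 2"
    using q by (auto simp: \<alpha>_def field_simps)
  \<comment> \<open>The three summands bound the Laplacian of the barrier, the drift and the
    \<open>G\<close> term at the touching point, each in units of \<open>t / R\<^sup>2 * E\<close>.
    None depends on the centre of the ball.\<close>
  define C\<^sub>0 where "C\<^sub>0 = 2 * \<alpha> * (?N + 2 * (\<alpha> + 1)) + ?c * (2 * \<alpha>) + \<bar>lam\<bar> * (1 + 2 * \<alpha>)"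
  have C\<^sub>0: "C\<^sub>0 > 0"
    unfolding C\<^sub>0_def using \<alpha> dim by (intro add_pos_nonneg mult_pos_pos) auto
  have "norm x\<^sub>0 powr \<theta> * u x\<^sub>0 powr (q - 1) \<le> 4 * C\<^sub>0 * (3 / 2) powr (- \<theta>) / (norm x\<^sub>0)\<^sup>2"
    if "x\<^sub>0 \<noteq> 0" and sub: "cball x\<^sub>0 (norm x\<^sub>0 / 2) \<subseteq> \<Omega>" for x\<^sub>0
  proof -
    define R where "R = norm x\<^sub>0 / 2"
    have R: "R > 0" "norm x\<^sub>0 = 2 * R"
      using that by (auto simp: R_def)
    have norm_range: "R \<le> norm x" "norm x \<le> 3 * R" if "x \<in> cball x\<^sub>0 R" for x
    proof -
      have "norm (x - x\<^sub>0) \<le> R"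
        using that by (simp add: dist_norm norm_minus_commute)
      then show "R \<le> norm x" "norm x \<le> 3 * R"
        using norm_triangle_ineq2[of x x\<^sub>0] norm_triangle_ineq2[of x\<^sub>0 x] R(2)
        by (simp_all add: norm_minus_commute)
    qed
    have cball: "cball x\<^sub>0 R \<subseteq> \<Omega> - {0}"
      using sub norm_range(1)[of 0] R(1) by (auto simp: R_def)
    define d where "d x = 1 - ((x - x\<^sub>0) \<bullet> (x - x\<^sub>0)) / R\<^sup>2" for x
    have d_nonneg: "0 \<le> d x" if "x \<in> cball x\<^sub>0 R" for x
    proof -
      have "(norm (x - x\<^sub>0))\<^sup>2 \<le> R\<^sup>2"
        using that R by (intro power_mono) (auto simp: dist_norm norm_minus_commute)
      then show ?thesis
        using R by (simp add: d_def power2_norm_eq_inner)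
    qed
    have d_pos: "0 < d x" if "x \<in> ball x\<^sub>0 R" for x
      unfolding d_def using that by (rule ball_weight_pos)
    have d_le: "d x \<le> 1" for x
      by (simp add: d_def)
    have cd: "continuous_on A d" for A
      unfolding d_def using R(1) by (intro continuous_intros) auto
    have "continuous_on (cball x\<^sub>0 R) (\<lambda>x. u x * d x powr \<alpha>)"
      using \<alpha>(1) d_nonneg
      by (intro continuous_on_mult continuous_on_powr' cd continuous_on_const
          continuous_on_subset[OF continuous_u cball]) auto
    then obtain y where y: "y \<in> cball x\<^sub>0 R"
      and y_max: "\<And>x. x \<in> cball x\<^sub>0 R \<Longrightarrow> u x * d x powr \<alpha> \<le> u y * d y powr \<alpha>"
      using continuous_attains_sup[of "cball x\<^sub>0 R" "\<lambda>x. u x * d x powr \<alpha>"] R(1)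
      by (metis centre_in_cball compact_cball empty_iff less_imp_le)
    \<comment> \<open>The least multiple for which the barrier lies above \<open>u\<close> on the
      ball. It is at least the value of \<open>u\<close> at the centre, where \<open>d\<close> is 1,
      so an upper bound for \<open>t\<close> is enough.\<close>
    define t where "t = u y * d y powr \<alpha>"
    have u0: "0 < u x\<^sub>0" "u x\<^sub>0 \<le> t"
      using u_pos[of x\<^sub>0] subsetD[OF cball, of x\<^sub>0] R(1) y_max[of x\<^sub>0] by (auto simp: d_def t_def)
    then have t: "t > 0"
      by simp
    have yb: "y \<in> ball x\<^sub>0 R"
    proof (rule ccontr)
      assume "y \<notin> ball x\<^sub>0 R"
      then have "norm (y - x\<^sub>0) = R"
        using y by (simp add: dist_norm norm_minus_commute)
      then have "d y = 0"
        using R(1) by (simp add: d_def flip: power2_norm_eq_inner)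
      then show False
        using t by (simp add: t_def)
    qed
    have dy: "0 < d y" "d y \<le> 1"
      using d_pos[OF yb] d_le by auto
    define w where "w x = t * d x powr (- \<alpha>)" for x
    define c where "c = 2 * \<alpha> * t / R\<^sup>2"
    have c: "c > 0"
      using \<alpha>(1) t R(1) by (simp add: c_def)
    define W where "W x = (c * d x powr (- \<alpha> - 1)) *\<^sub>R (x - x\<^sub>0)" for x
    define W' where "W' x h = (c * d x powr (- \<alpha> - 1)) *\<^sub>R h
      + (c * (2 * (\<alpha> + 1) / R\<^sup>2 * d x powr (- \<alpha> - 2) * (h \<bullet> (x - x\<^sub>0)))) *\<^sub>R (x - x\<^sub>0)" for x h
    have w: "GDERIV w x :> W x" if "x \<in> ball x\<^sub>0 R" for x
    proof -
      have "(w has_derivative (\<lambda>h. t * (2 * \<alpha> / R\<^sup>2 * d x powr (- \<alpha> - 1) * (h \<bullet> (x - x\<^sub>0))))) (at x)"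
        unfolding w_def d_def by (rule has_derivative_mult_right[OF ball_weight_powr_has_derivative[OF that]])
      then show ?thesis
        unfolding gderiv_def by (rule has_derivative_eq_rhs) (auto simp: W_def c_def fun_eq_iff)
    qed
    have W: "(W has_derivative W' x) (at x)" if "x \<in> ball x\<^sub>0 R" for x
    proof -
      have e: "- (\<alpha> + 1) = - \<alpha> - 1" "- \<alpha> - 1 - 1 = - \<alpha> - 2"
        by auto
      have "((\<lambda>x. d x powr (- (\<alpha> + 1))) has_derivative
          (\<lambda>h. 2 * (\<alpha> + 1) / R\<^sup>2 * d x powr (- (\<alpha> + 1) - 1) * (h \<bullet> (x - x\<^sub>0)))) (at x)"
        unfolding d_def by (rule ball_weight_powr_has_derivative[OF that])
      then have "((\<lambda>x. c * d x powr (- \<alpha> - 1)) has_derivative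
          (\<lambda>h. c * (2 * (\<alpha> + 1) / R\<^sup>2 * d x powr (- \<alpha> - 2) * (h \<bullet> (x - x\<^sub>0))))) (at x)"
        unfolding e by (rule has_derivative_mult_right)
      moreover have "((\<lambda>x. x - x\<^sub>0) has_derivative (\<lambda>h. h)) (at x)"
        by (auto intro!: derivative_eq_intros)
      ultimately show ?thesis
        unfolding W_def W'_def by (rule has_derivative_scaleR)
    qed
    have cW': "continuous_on (ball x\<^sub>0 R) (\<lambda>x. W' x b \<bullet> b)" for b
    proof -
      have "\<forall>x\<in>ball x\<^sub>0 R. d x \<noteq> 0"
        using d_pos by fastforce
      then show ?thesis
        unfolding W'_def using R(1) by (intro continuous_intros cd) auto
    qed
    have max: "u x - w x \<le> u y - w y" if "x \<in> ball x\<^sub>0 R" for x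
    proof -
      have "u x * d x powr \<alpha> \<le> t"
        using y_max[of x] that by (simp add: t_def)
      then have "u x \<le> w x"
        using d_pos[OF that] by (simp add: w_def powr_minus field_simps)
      moreover have "u y = w y"
        using dy by (simp add: w_def t_def powr_minus)
      ultimately show ?thesis
        by simp
    qed
    have S: "ball x\<^sub>0 R \<subseteq> \<Omega> - {0}"
      using cball ball_subset_cball by blast
    note touch = touching_from_above[OF open_ball S yb w W cW' max]
    \<comment> \<open>The strongest singularity present; as \<open>d y\<close> is at most 1, it
      dominates the other powers of \<open>d y\<close> and can be factored out of all terms.\<close>
    define E where "E = d y powr (- \<alpha> - 2)"
    have E: "E > 0" "d y powr (- \<alpha> - 1) \<le> E" "d y powr (- \<alpha>) \<le> E"
      using dy by (auto simp: E_def intro!: powr_mono')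
    have yx: "norm (y - x\<^sub>0) \<le> R"
      using y by (simp add: dist_norm norm_minus_commute)
    have ny: "R \<le> norm y" "norm y \<le> 3 * R"
      using norm_range[OF y] .
    have uy: "u y = t * d y powr (- \<alpha>)"
      using dy by (simp add: t_def powr_minus)
    have norm_W: "norm (W y) \<le> 2 * \<alpha> * t / R * E"
    proof -
      have "norm (W y) = c * d y powr (- \<alpha> - 1) * norm (y - x\<^sub>0)"
        using c by (simp add: W_def)
      also have "\<dots> \<le> c * E * R"
        using c E yx by (intro mult_mono) auto
      finally show ?thesis
        using R(1) by (simp add: c_def power2_eq_square)
    qed
    have div: "(\<Sum>b\<in>Basis. W' y b \<bullet> b) \<le> (t / R\<^sup>2 * E) * (2 * \<alpha> * (?N + 2 * (\<alpha> + 1)))"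
    proof -
      have "(\<Sum>b\<in>Basis. W' y b \<bullet> b)
          = c * d y powr (- \<alpha> - 1) * ?N + c * (2 * (\<alpha> + 1) / R\<^sup>2 * E) * (\<Sum>b\<in>Basis. ((y - x\<^sub>0) \<bullet> b) * ((y - x\<^sub>0) \<bullet> b))"
        by (simp add: W'_def E_def inner_add_left sum.distrib inner_same_Basis sum_distrib_left
            sum_divide_distrib inner_commute[of _ "y - x\<^sub>0"] ac_simps)
      also have "\<dots> = c * d y powr (- \<alpha> - 1) * ?N + c * (2 * (\<alpha> + 1) / R\<^sup>2 * E) * (norm (y - x\<^sub>0))\<^sup>2"
        by (simp only: euclidean_inner[symmetric] power2_norm_eq_inner)
      also have "\<dots> \<le> c * E * ?N + c * (2 * (\<alpha> + 1) / R\<^sup>2 * E) * R\<^sup>2"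
        using c E \<alpha>(1) yx R(1) by (intro add_mono mult_mono mult_nonneg_nonneg power_mono) auto
      also have "\<dots> = (t / R\<^sup>2 * E) * (2 * \<alpha> * (?N + 2 * (\<alpha> + 1)))"
        using R(1) by (simp add: c_def field_simps)
      finally show ?thesis .
    qed
    have drift: "- drift \<rho> u y \<le> (t / R\<^sup>2 * E) * (?c * (2 * \<alpha>))"
    proof -
      have "- drift \<rho> u y \<le> ?c * (norm (W y) / norm y)"
        using abs_drift_le[of \<rho> u y] touch(1) by simp
      also have "\<dots> \<le> ?c * ((2 * \<alpha> * t / R * E) / R)"
        using norm_W ny(1) R(1) \<alpha>(1) t E(1) by (intro mult_left_mono frac_le) auto
      also have "\<dots> = (t / R\<^sup>2 * E) * (?c * (2 * \<alpha>))"
        by (simp add: power2_eq_square)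
      finally show ?thesis .
    qed
    have G: "lam * G \<tau> y (u y) (grad u y) \<le> (t / R\<^sup>2 * E) * (\<bar>lam\<bar> * (1 + 2 * \<alpha>))"
    proof -
      have y0: "y \<in> \<Omega> - {0}"
        using subsetD[OF S yb] .
      have "lam * G \<tau> y (u y) (grad u y) \<le> \<bar>lam\<bar> * G \<tau> y (u y) (grad u y)"
        by (intro mult_right_mono G_nonneg) auto
      also have "\<dots> \<le> \<bar>lam\<bar> * ((u y / norm y + norm (W y)) / norm y)"
        using G_le[OF \<tau>, of "u y" y "W y"] u_pos[OF y0] y0 touch(1) by (intro mult_left_mono) auto
      also have "\<dots> \<le> \<bar>lam\<bar> * ((t * E / R + 2 * \<alpha> * t / R * E) / R)"
        using norm_W ny(1) R(1) \<alpha>(1) t E unfolding uy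
        by (intro mult_left_mono frac_le add_mono add_nonneg_nonneg) auto
      also have "\<dots> = (t / R\<^sup>2 * E) * (\<bar>lam\<bar> * (1 + 2 * \<alpha>))"
        using R(1) by (simp add: power2_eq_square field_simps)
      finally show ?thesis .
    qed
    have "norm y powr \<theta> * u y powr q \<le> (t / R\<^sup>2 * E) * C\<^sub>0"
      using touch(2) div drift G unfolding rhs_def C\<^sub>0_def by (simp add: distrib_left)
    moreover have "u y powr q = t powr (q - 1) * t * E"
      using t dy(1) \<alpha>(2) by (simp add: uy E_def powr_mult powr_powr powr_diff algebra_simps)
    ultimately have "(t * E) * (norm y powr \<theta> * t powr (q - 1)) \<le> (t * E) * (C\<^sub>0 / R\<^sup>2)"
      by (simp add: field_simps)
    then have 1: "norm y powr \<theta> * t powr (q - 1) \<le> C\<^sub>0 / R\<^sup>2"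
      using t E(1) by (auto intro: mult_left_le_imp_le)
    \<comment> \<open>Transfer from \<open>y\<close> back to the centre: \<open>norm y\<close> is at
      most \<open>3 * R\<close>, which is 3/2 times the norm of the centre, and \<theta> is
      negative. The factor 4 of the final constant comes from \<open>R\<close> being half that
      norm.\<close>
    have "(3 / 2) powr \<theta> * (norm x\<^sub>0 powr \<theta> * u x\<^sub>0 powr (q - 1)) = (3 * R) powr \<theta> * u x\<^sub>0 powr (q - 1)"
      using R by (simp add: powr_mult[symmetric])
    also have "\<dots> \<le> norm y powr \<theta> * t powr (q - 1)"
      using ny R(1) \<theta> q u0 by (intro mult_mono powr_mono2' powr_mono2) auto
    also have "\<dots> \<le> C\<^sub>0 / R\<^sup>2"
      by (rule 1)
    finally have "norm x\<^sub>0 powr \<theta> * u x\<^sub>0 powr (q - 1) \<le> (C\<^sub>0 / R\<^sup>2) / (3 / 2) powr \<theta>"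
      by (subst pos_le_divide_eq) (auto simp: mult.commute)
    also have "\<dots> = 4 * C\<^sub>0 * (3 / 2) powr (- \<theta>) / (norm x\<^sub>0)\<^sup>2"
      by (simp add: R_def powr_minus field_simps)
    finally show ?thesis .
  qed
  moreover have "4 * C\<^sub>0 * (3 / 2) powr (- \<theta>) > 0"
    using C\<^sub>0 by simp
  ultimately show thesis
    using that by blast
qed

end

subsection \<open>The energy estimate\<close>

lemma nn_integral_abs_powr_finite:
  fixes c r :: real
  assumes "- 1 < c" "0 < r"
  shows "(\<integral>\<^sup>+t. ennreal (indicator {-r..r} t * \<bar>t\<bar> powr c) \<partial>lborel) < \<infinity>"
proof -
  obtain I where "((\<lambda>t. t powr c) has_integral I) {0..r}"
    using has_integral_powr_from_0[OF assms(1), of r] assms(2) by (meson less_imp_le)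
  then have 1: "((\<lambda>t. \<bar>t\<bar> powr c) has_integral I) {0..r}"
    by (rule has_integral_eq[rotated]) auto
  then have "((\<lambda>t. \<bar>t\<bar> powr c) has_integral I) {-r..-0}"
    using has_integral_reflect_real[of "\<lambda>t. \<bar>t\<bar> powr c" I r 0] by simp
  with 1 have "((\<lambda>t. \<bar>t\<bar> powr c) has_integral (I + I)) {-r..r}"
    using assms(2) by (intro has_integral_combine[of "-r" 0 r]) auto
  then have "(\<integral>\<^sup>+t. ennreal (indicator {-r..r} t * \<bar>t\<bar> powr c) \<partial>lborel) = ennreal (I + I)"
    by (intro nn_integral_has_integral_lebesgue) auto
  then show ?thesis
    by simp
qed

text \<open>Reduction to one dimension: \<open>\<bar>x\<bar> powr p \<le> (\<Prod>b. \<bar>x \<bullet> b\<bar> powr (p / N))\<close> off the coordinate hyperplanes.\<close>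

lemma set_integrable_norm_powr:
  fixes p r :: real
  assumes "- real DIM('a::euclidean_space) < p" "p \<le> 0"
  shows "set_integrable lborel (cball (0::'a) r) (\<lambda>x. norm x powr p)"
proof -
  let ?N = "real DIM('a)"
  define R where "R = \<bar>r\<bar> + 1"
  have R: "R > 0" "r \<le> R"
    by (auto simp: R_def)
  \<comment> \<open>Distributing the exponent evenly over the coordinates turns the condition p > -
    N into integrability of a one-dimensional power with exponent above -1.\<close>
  define c where "c = p / ?N"
  have c: "- 1 < c" "c \<le> 0" "?N * c = p"
    using assms by (auto simp: c_def field_simps)
  let ?f = "\<lambda>t. indicator {-R..R} t * \<bar>t\<bar> powr c"
  \<comment> \<open>On these hyperplanes the product bound fails, because \<open>0 powr c\<close> is
    0 even for negative \<open>c\<close>.\<close>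
  have null: "AE x::'a in lborel. \<forall>b\<in>Basis. x \<bullet> b \<noteq> 0"
  proof (subst AE_finite_all)
    show "\<forall>b\<in>Basis. AE x::'a in lborel. x \<bullet> b \<noteq> 0"
    proof
      fix b :: 'a assume "b \<in> Basis"
      then have "negligible {x. x \<bullet> b = 0}"
        by (rule negligible_standard_hyperplane)
      then have "{x. x \<bullet> b = 0} \<in> null_sets lebesgue"
        by (simp add: negligible_iff_null_sets)
      moreover have "{x. x \<bullet> b = 0} \<in> sets borel"
        by (intro borel_closed closed_Collect_eq continuous_intros)
      ultimately have "{x. x \<bullet> b = 0} \<in> null_sets lborel"
        by (auto simp: null_sets_def)
      then show "AE x in lborel. x \<bullet> b \<noteq> 0"
        using AE_not_in by force
    qed
  qed simp
  have "(\<integral>\<^sup>+x. ennreal (norm (indicator (cball (0::'a) r) x *\<^sub>R norm x powr p)) \<partial>lborel)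
      \<le> (\<integral>\<^sup>+x. (\<Prod>b\<in>Basis. ennreal (?f ((x::'a) \<bullet> b))) \<partial>lborel)"
  proof (rule nn_integral_mono_AE)
    show "AE x::'a in lborel. ennreal (norm (indicator (cball 0 r) x *\<^sub>R norm x powr p))
        \<le> (\<Prod>b\<in>Basis. ennreal (?f (x \<bullet> b)))"
      using null
    proof eventually_elim
      fix x :: 'a assume x: "\<forall>b\<in>Basis. x \<bullet> b \<noteq> 0"
      show "ennreal (norm (indicator (cball 0 r) x *\<^sub>R norm x powr p)) \<le> (\<Prod>b\<in>Basis. ennreal (?f (x \<bullet> b)))"
      proof (cases "norm x \<le> r")
        case True
        have le: "\<bar>x \<bullet> b\<bar> \<le> norm x" if "b \<in> Basis" for b
          using that by (rule Basis_le_norm)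
        have "x \<noteq> 0"
          using x nonempty_Basis by fastforce
        then have "norm x powr p = (\<Prod>b\<in>(Basis::'a set). norm x powr c)"
          by (simp add: powr_realpow[symmetric] powr_powr c(3)[symmetric] mult.commute)
        also have "\<dots> \<le> (\<Prod>b\<in>Basis. ?f (x \<bullet> b))"
        proof (rule prod_mono)
          fix b :: 'a assume b: "b \<in> Basis"
          have "norm x powr c \<le> \<bar>x \<bullet> b\<bar> powr c"
            using c(2) x b le[OF b] by (intro powr_mono2') auto
          moreover have "x \<bullet> b \<in> {-R..R}"
            using le[OF b] True R(2) by auto
          ultimately show "0 \<le> norm x powr c \<and> norm x powr c \<le> ?f (x \<bullet> b)"
            by simp
        qed
        finally have "ennreal (norm x powr p) \<le> ennreal (\<Prod>b\<in>Basis. ?f (x \<bullet> b))"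
          by (rule ennreal_leI)
        also have "\<dots> = (\<Prod>b\<in>Basis. ennreal (?f (x \<bullet> b)))"
          by (simp add: prod_ennreal)
        finally show ?thesis
          using True by simp
      qed simp
    qed
  qed
  also have "\<dots> = (\<Prod>b\<in>(Basis::'a set). \<integral>\<^sup>+t. ennreal (?f t) \<partial>lborel)"
    by (rule nn_integral_lborel_prod) auto
  also have "\<dots> < \<infinity>"
    using nn_integral_abs_powr_finite[OF c(1) R(1)]
    by (simp add: power_less_top_ennreal)
  finally have "(\<integral>\<^sup>+x. ennreal (norm (indicator (cball (0::'a) r) x *\<^sub>R norm x powr p)) \<partial>lborel) < \<infinity>" .
  moreover have "(\<lambda>x. indicator (cball (0::'a) r) x *\<^sub>R norm x powr p) \<in> borel_measurable lborel"
    by (intro borel_measurable_scaleR borel_measurable_indicator powr_real_measurable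
        borel_measurable_norm) auto
  ultimately show ?thesis
    unfolding set_integrable_def by (intro integrableI_bounded)
qed

text \<open>Used to drop the inner cutoff from the energy bound, where only uniform bounds for the
  integrals are at hand and no dominating function.\<close>

lemma integrable_Fatou:
  fixes f :: "nat \<Rightarrow> 'a \<Rightarrow> real"
  assumes int: "\<And>n. integrable M (f n)" and nonneg: "\<And>n x. 0 \<le> f n x"
    and bound: "\<And>n. (LINT x|M. f n x) \<le> C" and lim: "\<And>x. (\<lambda>n. f n x) \<longlonglongrightarrow> g x"
    and meas: "g \<in> borel_measurable M"
  shows "integrable M g"
proof (rule integrableI_bounded[OF meas])
  have g: "0 \<le> g x" for x
    using lim[of x] nonneg by (intro LIMSEQ_le_const) auto
  have "(\<integral>\<^sup>+x. ennreal (norm (g x)) \<partial>M) = (\<integral>\<^sup>+x. liminf (\<lambda>n. ennreal (f n x)) \<partial>M)"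
  proof (rule nn_integral_cong)
    fix x
    have "(\<lambda>n. ennreal (f n x)) \<longlonglongrightarrow> ennreal (g x)"
      using lim by (rule tendsto_ennrealI)
    then show "ennreal (norm (g x)) = liminf (\<lambda>n. ennreal (f n x))"
      using g by (simp add: lim_imp_Liminf)
  qed
  also have "\<dots> \<le> liminf (\<lambda>n. \<integral>\<^sup>+x. ennreal (f n x) \<partial>M)"
    using int by (intro nn_integral_liminf) auto
  also have "\<dots> \<le> liminf (\<lambda>n. ennreal C)"
    using bound nonneg int
    by (intro Liminf_mono always_eventually allI) (simp add: nn_integral_eq_integral ennreal_leI)
  also have "\<dots> < \<infinity>"
    by (simp add: Liminf_const)
  finally show "(\<integral>\<^sup>+x. ennreal (norm (g x)) \<partial>M) < \<infinity>" .
qed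

text \<open>The cutoffs are functions of \<open>s = \<bar>x\<bar>\<^sup>2\<close>; the case distinction is needed at \<open>s = 0\<close>, where \<open>e / s = 0\<close>.\<close>

definition inner_cutoff :: "real \<Rightarrow> real \<Rightarrow> real" where
  "inner_cutoff e s = (if s > 0 then (max 0 (1 - e / s))\<^sup>2 else 0)"

definition outer_cutoff :: "real \<Rightarrow> real \<Rightarrow> real" where
  "outer_cutoff r s = (max 0 (1 - s / r))\<^sup>2"

lemma inner_cutoff_range: "0 < e \<Longrightarrow> 0 \<le> inner_cutoff e s \<and> inner_cutoff e s \<le> 1"
  by (auto simp: inner_cutoff_def power_le_one)

lemma outer_cutoff_range: "0 < r \<Longrightarrow> 0 \<le> s \<Longrightarrow> 0 \<le> outer_cutoff r s \<and> outer_cutoff r s \<le> 1"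
  by (auto simp: outer_cutoff_def power_le_one)

lemma inner_cutoff_eq_0: "0 < e \<Longrightarrow> s \<le> e \<Longrightarrow> inner_cutoff e s = 0"
  by (auto simp: inner_cutoff_def max_def)

lemma outer_cutoff_eq_0: "0 < r \<Longrightarrow> r \<le> s \<Longrightarrow> outer_cutoff r s = 0"
  by (auto simp: outer_cutoff_def max_def)

definition inner_cutoff' :: "real \<Rightarrow> real \<Rightarrow> real" where
  "inner_cutoff' e s = 2 * max 0 (1 - e / s) * (e / s\<^sup>2)"

definition outer_cutoff' :: "real \<Rightarrow> real \<Rightarrow> real" where
  "outer_cutoff' r s = - (2 * max 0 (1 - s / r) / r)"

lemma inner_cutoff_DERIV:
  assumes "0 < s"
  shows "(inner_cutoff e has_real_derivative inner_cutoff' e s) (at s)"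
proof -
  have "((\<lambda>s. 1 - e / s) has_real_derivative e / s\<^sup>2) (at s)"
    using assms by (auto intro!: derivative_eq_intros simp: power2_eq_square)
  from DERIV_chain2[OF DERIV_positive_part_square this]
  have "((\<lambda>s. (max 0 (1 - e / s))\<^sup>2) has_real_derivative inner_cutoff' e s) (at s)"
    by (simp add: inner_cutoff'_def)
  then show ?thesis
    by (rule has_field_derivative_transform_within_open[where S = "{0<..}"])
      (use assms in \<open>auto simp: inner_cutoff_def\<close>)
qed

lemma outer_cutoff_DERIV: "0 < r \<Longrightarrow> (outer_cutoff r has_real_derivative outer_cutoff' r s) (at s)"
proof -
  assume "0 < r"
  then have "((\<lambda>s. 1 - s / r) has_real_derivative - (1 / r)) (at s)"
    by (auto intro!: derivative_eq_intros)
  from DERIV_chain2[OF DERIV_positive_part_square this] show ?thesis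
    unfolding outer_cutoff_def[abs_def] outer_cutoff'_def by simp
qed

text \<open>With s = |x|^2 the gradient of a radial function k(s) is 2 k'(s) x, so a bound on s
  |k'(s)| is the same as a gradient of order 1 / |x|. The constant is independent of
  \<open>e\<close>, which is what survives the limit.\<close>

lemma inner_cutoff'_bound:
  assumes "0 < e" "0 < s"
  shows "s * \<bar>inner_cutoff' e s\<bar> \<le> 2"
proof (cases "e \<le> s")
  case True
  have "max 0 (1 - e / s) * (e / s) \<le> 1 * 1"
    using assms True by (intro mult_mono) auto
  moreover have "s * \<bar>inner_cutoff' e s\<bar> = 2 * (max 0 (1 - e / s) * (e / s))"
    using assms by (simp add: inner_cutoff'_def abs_mult power2_eq_square)
  ultimately show ?thesis
    by simp
qed (use assms in \<open>simp add: inner_cutoff'_def max_def field_simps\<close>)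

lemma outer_cutoff'_bound:
  assumes "0 < r" "0 < s"
  shows "s * \<bar>outer_cutoff' r s\<bar> \<le> 2"
proof (cases "s \<le> r")
  case True
  have "max 0 (1 - s / r) * (s / r) \<le> 1 * 1"
    using assms True by (intro mult_mono) auto
  moreover have "s * \<bar>outer_cutoff' r s\<bar> = 2 * (max 0 (1 - s / r) * (s / r))"
    using assms by (simp add: outer_cutoff'_def abs_mult)
  ultimately show ?thesis
    by simp
qed (use assms in \<open>simp add: outer_cutoff'_def max_def field_simps\<close>)

lemma inner_cutoff'_continuous: "continuous_on {0<..} (inner_cutoff' e)"
  unfolding inner_cutoff'_def by (intro continuous_intros) auto

lemma outer_cutoff'_continuous: "0 < r \<Longrightarrow> continuous_on A (outer_cutoff' r)"
  unfolding outer_cutoff'_def by (intro continuous_intros) auto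

lemma GDERIV_radial:
  assumes "(k has_real_derivative k') (at (x \<bullet> x))"
  shows "GDERIV (\<lambda>x. k (x \<bullet> x)) x :> (2 * k') *\<^sub>R x"
proof -
  have "GDERIV (\<lambda>x. x \<bullet> x) x :> 2 *\<^sub>R x"
    unfolding gderiv_def by (auto intro!: derivative_eq_intros simp: inner_commute)
  from GDERIV_DERIV_compose[OF this assms] show ?thesis
    by (simp add: mult.commute)
qed

section \<open>Decay and weighted energy of the solution\<close>

context positive_solution_near_0
begin

text \<open>The Keller-Osserman bound is solved for \<open>u\<close>. For the absorption one factor
  \<open>u\<close> is split off: the remaining |x|^\<theta> u^(q-1) is at most a multiple of
  |x|^(-2), and the split factor supplies the power \<gamma>.\<close>

lemma decay_near_0:
  obtains R \<gamma> C where "0 < R" "R \<le> 1" "cball 0 R \<subseteq> \<Omega>" "0 < \<gamma>" "\<gamma> \<le> 1" "0 < C"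
    "\<forall>x\<in>cball (0::'a) R - {0}. u x \<le> C * norm x powr \<gamma>
      \<and> norm x powr \<theta> * u x powr q \<le> C * norm x powr (\<gamma> - 2)"
proof -
  obtain C where C: "C > 0" and KO: "\<And>x. x \<noteq> 0 \<Longrightarrow> cball x (norm x / 2) \<subseteq> \<Omega> \<Longrightarrow>
      norm x powr \<theta> * u x powr (q - 1) \<le> C / (norm x)\<^sup>2"
    using Keller_Osserman by metis
  obtain e where e: "e > 0" "cball 0 e \<subseteq> \<Omega>"
    using \<Omega> open_contains_cball by blast
  \<comment> \<open>Half of \<open>e\<close> keeps the balls of radius |x| / 2 about x inside the
    domain; the bound 1 allows exponents to be lowered at will.\<close>
  define R where "R = min 1 (e / 2)"
  have R: "0 < R" "R \<le> 1" "2 * R \<le> e"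
    using e by (auto simp: R_def)
  have R_sub: "cball 0 R \<subseteq> \<Omega>"
    using e R by (auto intro!: subsetD[OF e(2)])
  define \<gamma>\<^sub>0 where "\<gamma>\<^sub>0 = (- \<theta> - 2) / (q - 1)"
  have \<gamma>\<^sub>0: "\<gamma>\<^sub>0 > 0" "\<gamma>\<^sub>0 * (q - 1) = - \<theta> - 2"
    using q \<theta> by (auto simp: \<gamma>\<^sub>0_def)
  \<comment> \<open>The cap keeps \<gamma> - 2 negative, as the integrability lemma for powers of
    the norm expects, and keeps the derivative of the weight under a fixed constant.\<close>
  define \<gamma> where "\<gamma> = min \<gamma>\<^sub>0 1"
  define A where "A = C powr (1 / (q - 1))"
  have A: "A > 0" "A powr (q - 1) = C"
    using C q by (auto simp: A_def powr_powr)
  have 1: "u x \<le> A * norm x powr \<gamma>"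
    and 2: "norm x powr \<theta> * u x powr q \<le> (C * A) * norm x powr (\<gamma> - 2)"
    if "0 < norm x" "norm x \<le> R" for x
  proof -
    let ?n = "norm x"
    have x: "x \<in> \<Omega> - {0}"
      using that R_sub by auto
    have sub: "cball x (?n / 2) \<subseteq> \<Omega>"
    proof
      fix y assume "y \<in> cball x (?n / 2)"
      then have "norm (y - x) \<le> ?n / 2"
        by (simp add: dist_norm norm_minus_commute)
      then have "norm y \<le> e"
        using norm_triangle_ineq2[of y x] that R by linarith
      then show "y \<in> \<Omega>"
        using e(2) by auto
    qed
    have *: "?n powr \<theta> * u x powr (q - 1) \<le> C / ?n\<^sup>2"
      using KO[OF _ sub] that by auto
    then have "u x powr (q - 1) \<le> C / ?n\<^sup>2 / ?n powr \<theta>"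
      using * that by (subst pos_le_divide_eq) (auto simp: mult.commute)
    also have "\<dots> = C * ?n powr (- \<theta> - 2)"
      using that by (simp add: powr_diff powr_minus field_simps)
    also have "\<dots> = (A * ?n powr \<gamma>\<^sub>0) powr (q - 1)"
      using A by (simp add: powr_mult powr_powr \<gamma>\<^sub>0)
    finally have "u x \<le> A * ?n powr \<gamma>\<^sub>0"
      using powr_less_mono2[of "q - 1" "A * ?n powr \<gamma>\<^sub>0" "u x"] q A by (auto simp: not_le[symmetric])
    also have "\<dots> \<le> A * ?n powr \<gamma>"
      using that R A by (intro mult_left_mono powr_mono') (auto simp: \<gamma>_def)
    finally show ux: "u x \<le> A * ?n powr \<gamma>" .
    have "?n powr \<theta> * u x powr q = (?n powr \<theta> * u x powr (q - 1)) * u x"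
      using u_pos[OF x] by (simp add: powr_diff)
    also have "\<dots> \<le> (C / ?n\<^sup>2) * (A * ?n powr \<gamma>)"
      using * ux u_pos[OF x] C by (intro mult_mono) auto
    also have "\<dots> = (C * A) * ?n powr (\<gamma> - 2)"
      using that by (simp add: powr_diff)
    finally show "?n powr \<theta> * u x powr q \<le> (C * A) * ?n powr (\<gamma> - 2)" .
  qed
  let ?C = "max A (C * A)"
  show thesis
  proof (rule that[of R \<gamma> ?C])
    show "\<forall>x\<in>cball (0::'a) R - {0}. u x \<le> ?C * norm x powr \<gamma>
      \<and> norm x powr \<theta> * u x powr q \<le> ?C * norm x powr (\<gamma> - 2)"
    proof
      fix x :: 'a assume "x \<in> cball 0 R - {0}"
      then have x: "0 < norm x" "norm x \<le> R"
        by auto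
      show "u x \<le> ?C * norm x powr \<gamma> \<and> norm x powr \<theta> * u x powr q \<le> ?C * norm x powr (\<gamma> - 2)"
        using 1[OF x] mult_right_mono[of A ?C "norm x powr \<gamma>"]
          2[OF x] mult_right_mono[of "C * A" ?C "norm x powr (\<gamma> - 2)"] by force
    qed
  qed (use R R_sub \<gamma>\<^sub>0 A C in \<open>auto simp: \<gamma>_def\<close>)
qed

lemma tendsto_0_at_0: "(u \<longlongrightarrow> 0) (at 0)"
proof -
  obtain R \<gamma> C where R: "0 < R" "cball 0 R \<subseteq> \<Omega>" and \<gamma>: "0 < \<gamma>"
    and le: "\<forall>x\<in>cball 0 R - {0}. u x \<le> C * norm x powr \<gamma>"
    using decay_near_0 by metis
  have ev: "\<forall>\<^sub>F x in at 0. 0 < norm x \<and> norm x \<le> R"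
    unfolding eventually_at using R(1) by (intro exI[of _ R]) auto
  show ?thesis
  proof (rule real_tendsto_sandwich[where f = "\<lambda>x. 0"])
    show "\<forall>\<^sub>F x in at 0. 0 \<le> u x"
      using ev by eventually_elim (use R in \<open>auto intro!: less_imp_le[OF u_pos]\<close>)
    show "\<forall>\<^sub>F x in at 0. u x \<le> C * norm x powr \<gamma>"
      using ev by eventually_elim (use le in auto)
    have "((\<lambda>x::'a. norm x powr \<gamma>) \<longlongrightarrow> 0 powr \<gamma>) (at 0)"
      using \<gamma> by (intro tendsto_powr' tendsto_norm_zero tendsto_ident_at) auto
    then show "((\<lambda>x::'a. C * norm x powr \<gamma>) \<longlongrightarrow> 0) (at 0)"
      by (intro tendsto_mult_right_zero) simp
  qed simp
qed

text \<open>The test function is \<open>\<zeta>\<^sup>2 u\<close> with \<open>\<zeta> = \<bar>x\<bar> powr (- \<gamma> / 2)\<close> times cutoffs near 0 and near the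
  sphere of radius \<open>R\<close>; the resulting bound does not depend on the inner cutoff.\<close>

lemma weighted_energy_bound:
  assumes R: "0 < R" "cball 0 R \<subseteq> \<Omega>" and \<gamma>: "0 < \<gamma>" "\<gamma> \<le> 1" and C: "0 \<le> C"
    and decay: "\<And>x. 0 < norm x \<Longrightarrow> norm x \<le> R \<Longrightarrow> u x \<le> C * norm x powr \<gamma>"
  obtains M where "\<forall>e>0.
      integrable lborel (\<lambda>x. (inner_cutoff e (x \<bullet> x) * outer_cutoff (R\<^sup>2) (x \<bullet> x))\<^sup>2
        * (norm x powr (- \<gamma>) * (norm (grad u x))\<^sup>2)) \<and>
      (LINT x|lborel. (inner_cutoff e (x \<bullet> x) * outer_cutoff (R\<^sup>2) (x \<bullet> x))\<^sup>2
        * (norm x powr (- \<gamma>) * (norm (grad u x))\<^sup>2)) \<le> M"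
proof -
  let ?V = "\<Omega> - {0}"
  define L where "L = \<bar>lam\<bar> + \<bar>real DIM('a) - 2 + 2 * \<rho>\<bar>"
  \<comment> \<open>\<open>L\<close> collects the coefficients of the mixed term in |grad u| and u /
    |x|. The 20 comes from the gradient of the cutoff weight: |x| |grad \<zeta>| is at most 10 times
    |x|^(-\<gamma>/2), and differentiating the square of \<zeta> doubles this. The square of L + 20
    is the price of absorbing half of the energy.\<close>
  define A where "A = (\<bar>lam\<bar> + (L + 20)\<^sup>2 / 2) * C\<^sup>2"
  have L: "0 \<le> L"
    by (simp add: L_def)
  have int_powr: "set_integrable lborel (cball (0::'a) R) (\<lambda>x. norm x powr (\<gamma> - 2))"
    using \<gamma> dim by (intro set_integrable_norm_powr) auto
  define M where "M = 2 * (A * (LINT x:cball (0::'a) R|lborel. norm x powr (\<gamma> - 2)))"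
  have "integrable lborel (\<lambda>x. (inner_cutoff e (x \<bullet> x) * outer_cutoff (R\<^sup>2) (x \<bullet> x))\<^sup>2
        * (norm x powr (- \<gamma>) * (norm (grad u x))\<^sup>2)) \<and>
      (LINT x|lborel. (inner_cutoff e (x \<bullet> x) * outer_cutoff (R\<^sup>2) (x \<bullet> x))\<^sup>2
        * (norm x powr (- \<gamma>) * (norm (grad u x))\<^sup>2)) \<le> M" if e: "0 < e" for e
  proof -
    \<comment> \<open>The variable is s = |x|^2, so the exponent is half of - \<gamma> / 2.\<close>
    define k where "k s = s powr (- \<gamma> / 4) * (inner_cutoff e s * outer_cutoff (R\<^sup>2) s)" for s
    define k' where "k' s = (- \<gamma> / 4) * s powr (- \<gamma> / 4 - 1) * (inner_cutoff e s * outer_cutoff (R\<^sup>2) s)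
      + s powr (- \<gamma> / 4) * (inner_cutoff' e s * outer_cutoff (R\<^sup>2) s + inner_cutoff e s * outer_cutoff' (R\<^sup>2) s)" for s
    have R2: "0 < R\<^sup>2"
      using R by simp
    have k: "(k has_real_derivative k' s) (at s)" if "s > 0" for s
      unfolding k_def[abs_def] k'_def
      by (rule DERIV_cong[OF DERIV_mult[OF has_real_derivative_powr[OF that]
            DERIV_mult[OF inner_cutoff_DERIV[OF that] outer_cutoff_DERIV[OF R2]]]]) (simp add: algebra_simps)
    have k'_cont: "continuous_on {0<..} k'"
    proof -
      have "continuous_on {0<..} (inner_cutoff e)"
        using inner_cutoff_DERIV DERIV_isCont by (metis continuous_at_imp_continuous_on greaterThan_iff)
      moreover have "continuous_on {0<..} (outer_cutoff (R\<^sup>2))"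
        using outer_cutoff_DERIV[OF R2] DERIV_isCont by (metis continuous_at_imp_continuous_on)
      ultimately show ?thesis
        unfolding k'_def
        by (intro continuous_intros inner_cutoff'_continuous outer_cutoff'_continuous R2) auto
    qed
    have k_bound: "0 \<le> k s" "k s \<le> s powr (- \<gamma> / 4)" if "0 < s" for s
      using inner_cutoff_range[OF e, of s] outer_cutoff_range[OF R2, of s] that
      by (auto simp: k_def intro!: mult_left_le mult_le_one)
    \<comment> \<open>The 5 is 1 + 2 + 2: at most 1 from the power, since \<gamma> / 4 is below 1,
      and 2 from each cutoff.\<close>
    have k'_bound: "s * \<bar>k' s\<bar> \<le> 5 * s powr (- \<gamma> / 4)" if "0 < s" for s
    proof -
      let ?p = "s powr (- \<gamma> / 4)"
      let ?i = "inner_cutoff e s" and ?o = "outer_cutoff (R\<^sup>2) s"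
        and ?i' = "inner_cutoff' e s" and ?o' = "outer_cutoff' (R\<^sup>2) s"
      have r: "0 \<le> ?i" "?i \<le> 1" "0 \<le> ?o" "?o \<le> 1" "s * \<bar>?i'\<bar> \<le> 2" "s * \<bar>?o'\<bar> \<le> 2"
        using inner_cutoff_range[OF e, of s] outer_cutoff_range[OF R2, of s] that
          inner_cutoff'_bound[OF e that] outer_cutoff'_bound[OF R2 that] by auto
      have "s powr (- \<gamma> / 4 - 1) = ?p / s"
        using that by (subst powr_diff) auto
      then have eq: "s * k' s = ?p * ((- \<gamma> / 4) * (?i * ?o) + (s * ?i') * ?o + ?i * (s * ?o'))"
        using that unfolding k'_def by (simp add: field_simps)
      have "s * \<bar>k' s\<bar> = \<bar>s * k' s\<bar>"
        using that by (simp add: abs_mult)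
      also have "\<dots> = ?p * \<bar>(- \<gamma> / 4) * (?i * ?o) + (s * ?i') * ?o + ?i * (s * ?o')\<bar>"
        unfolding eq by (simp only: abs_mult[of ?p] abs_of_nonneg[OF powr_ge_zero])
      also have "\<dots> \<le> ?p * (1 * (1 * 1) + 2 * 1 + 1 * 2)"
      proof (intro mult_left_mono order_trans[OF abs_triangle_ineq] add_mono)
        show "\<bar>(- \<gamma> / 4) * (?i * ?o)\<bar> \<le> 1 * (1 * 1)"
          unfolding abs_mult using r \<gamma> by (intro mult_mono) auto
        show "\<bar>s * ?i' * ?o\<bar> \<le> 2 * 1" "\<bar>?i * (s * ?o')\<bar> \<le> 1 * 2"
          unfolding abs_mult using r that by (intro mult_mono; simp)+
      qed simp
      finally show ?thesis
        by simp
    qed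
    define \<zeta> where "\<zeta> x = k (x \<bullet> x)" for x :: 'a
    define D\<zeta> where "D\<zeta> x = (2 * k' (x \<bullet> x)) *\<^sub>R x" for x :: 'a
    have \<zeta>: "GDERIV \<zeta> x :> D\<zeta> x" if "x \<in> ?V" for x
      unfolding \<zeta>_def D\<zeta>_def using that by (intro GDERIV_radial k) auto
    define K where "K = {x::'a. e \<le> x \<bullet> x} \<inter> cball 0 R"
    have K: "compact K" "K \<subseteq> ?V"
    proof -
      have "closed {x::'a. e \<le> x \<bullet> x}"
        by (intro closed_Collect_le continuous_intros)
      then show "compact K"
        unfolding K_def by (intro closed_Int_compact) auto
      show "K \<subseteq> ?V"
        using R(2) e by (auto simp: K_def)
    qed
    have \<zeta>0: "\<zeta> x = 0" if "x \<notin> K" for x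
    proof (cases "e \<le> x \<bullet> x")
      case True
      then have "R < norm x"
        using that by (simp add: K_def)
      then have "R\<^sup>2 \<le> x \<bullet> x"
        using R(1) by (simp add: power_mono flip: power2_norm_eq_inner)
      then show ?thesis
        by (simp add: \<zeta>_def k_def outer_cutoff_eq_0[OF R2])
    qed (simp add: \<zeta>_def k_def inner_cutoff_eq_0[OF e])
    define \<phi> where "\<phi> x = (\<zeta> x)\<^sup>2 * u x" for x
    define D\<phi> where "D\<phi> x = (\<zeta> x)\<^sup>2 *\<^sub>R grad u x + (2 * \<zeta> x * u x) *\<^sub>R D\<zeta> x" for x
    have \<phi>: "GDERIV \<phi> x :> D\<phi> x" if "x \<in> ?V" for x
    proof -
      have "GDERIV (\<lambda>x. (\<zeta> x)\<^sup>2) x :> (2 * \<zeta> x) *\<^sub>R D\<zeta> x"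
        by (rule GDERIV_DERIV_compose[OF \<zeta>[OF that]]) (auto intro!: derivative_eq_intros)
      from GDERIV_mult[OF this u_GDERIV[OF that]] show ?thesis
        unfolding \<phi>_def D\<phi>_def by (simp add: algebra_simps)
    qed
    have cD\<zeta>: "continuous_on ?V D\<zeta>"
      unfolding D\<zeta>_def
      by (intro continuous_intros continuous_on_compose2[OF k'_cont]) auto
    have c\<zeta>: "continuous_on ?V \<zeta>"
      using \<zeta> by (rule GDERIV_continuous_on)
    have cD\<phi>: "continuous_on ?V D\<phi>"
      unfolding D\<phi>_def by (intro continuous_intros c\<zeta> cD\<zeta> continuous_u continuous_grad)
    have \<phi>C1: "\<phi> \<in> C1_c ?V"
      using C1_cI[OF open_punctured K \<phi> cD\<phi>] \<zeta>0 by (simp add: \<phi>_def)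
    define f where "f x = (\<zeta> x * norm (grad u x))\<^sup>2" for x
    define g where "g x = rhs x * \<phi> x - grad u x \<bullet> D\<phi> x" for x
    have cf: "continuous_on ?V f" and cg: "continuous_on ?V g"
      unfolding f_def g_def \<phi>_def
      by (intro continuous_intros c\<zeta> cD\<phi> continuous_u continuous_grad continuous_rhs)+
    have f: "set_integrable lborel ?V f" and g: "set_integrable lborel ?V g"
      using K \<zeta>0 by (auto intro!: set_integrable_zero_outside_compact[of K] intro: continuous_on_subset[OF cf]
          continuous_on_subset[OF cg] simp: f_def g_def \<phi>_def D\<phi>_def)
    have g0: "(LINT x:?V|lborel. g x) = 0"
    proof -
      have "(LINT x:?V|lborel. g x) = (LINT x:?V|lborel. rhs x * \<phi> x - grad u x \<bullet> grad \<phi> x)"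
        using open_punctured by (intro set_lebesgue_integral_cong) (auto simp: g_def grad_eq[OF \<phi>])
      then show ?thesis
        using weak_form[OF \<phi>C1] by simp
    qed
    \<comment> \<open>Here \<open>f\<close> is the energy density and \<open>g\<close> the integrand
      of the weak equation tested with \<phi>. As \<open>g\<close> has integral 0, a pointwise
      estimate of the sum bounds the energy without further integration by parts.\<close>
    have key: "f x / 2 + g x \<le> A * norm x powr (\<gamma> - 2)" if x: "x \<in> ?V" "norm x \<le> R" for x
    proof -
      let ?n = "norm x"
      define a where "a = norm (grad u x)"
      define U where "U = u x / ?n"
      define p where "p = ?n powr (- \<gamma> / 2)"
      have n: "?n > 0" and a: "0 \<le> a" and U: "0 \<le> U" and z: "0 \<le> \<zeta> x"
        using x u_pos[OF x(1)] k_bound(1)[of "x \<bullet> x"] by (auto simp: a_def U_def \<zeta>_def)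
      have sq: "(x \<bullet> x) powr (- \<gamma> / 4) = p"
        using n by (simp add: p_def powr_powr powr_numeral flip: power2_norm_eq_inner powr_numeral)
      have zp: "\<zeta> x \<le> p"
        using k_bound(2)[of "x \<bullet> x"] sq x by (simp add: \<zeta>_def)
      have Dzp: "?n * norm (D\<zeta> x) \<le> 10 * p"
        using k'_bound[of "x \<bullet> x"] sq x
        by (simp add: D\<zeta>_def power2_norm_eq_inner[symmetric] power2_eq_square abs_mult)
      have Up: "(U * p)\<^sup>2 \<le> C\<^sup>2 * ?n powr (\<gamma> - 2)"
      proof -
        have "U * p \<le> (C * ?n powr \<gamma> / ?n) * p"
          unfolding U_def using decay[of x] x n by (intro mult_right_mono divide_right_mono) (auto simp: p_def)
        also have "\<dots> = C * ?n powr (\<gamma> / 2 - 1)"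
        proof -
          have "\<gamma> / 2 - 1 = \<gamma> - 1 + - \<gamma> / 2"
            by simp
          then have "?n powr (\<gamma> / 2 - 1) = ?n powr (\<gamma> - 1) * p"
            unfolding p_def by (metis powr_add)
          also have "?n powr (\<gamma> - 1) = ?n powr \<gamma> / ?n"
            using n by (subst powr_diff) auto
          finally show ?thesis
            by simp
        qed
        finally have "(U * p)\<^sup>2 \<le> (C * ?n powr (\<gamma> / 2 - 1))\<^sup>2"
          using U by (intro power_mono) (auto simp: p_def)
        also have "\<dots> = C\<^sup>2 * ?n powr (\<gamma> - 2)"
          by (simp add: power_mult_distrib power2_eq_square flip: powr_add)
        finally show ?thesis .
      qed
      \<comment> \<open>The absorption enters with a negative sign and is discarded; the lower-order
        terms are quadratic in \<open>U\<close> and \<open>a\<close>, both of the scale of a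
        gradient.\<close>
      have rhs_u: "rhs x * u x \<le> \<bar>lam\<bar> * U\<^sup>2 + L * (a * U)"
      proof -
        have "rhs x \<le> \<bar>lam\<bar> * ((U + a) / ?n) + \<bar>real DIM('a) - 2 + 2 * \<rho>\<bar> * (a / ?n)"
        proof -
          have "lam * G \<tau> x (u x) (grad u x) \<le> \<bar>lam\<bar> * G \<tau> x (u x) (grad u x)"
            by (intro mult_right_mono G_nonneg) auto
          also have "\<dots> \<le> \<bar>lam\<bar> * ((U + a) / ?n)"
            unfolding U_def a_def using u_pos[OF x(1)] x by (intro mult_left_mono G_le \<tau>) auto
          moreover have "0 \<le> ?n powr \<theta> * u x powr q"
            by simp
          ultimately show ?thesis
            using abs_drift_le[of \<rho> u x] unfolding rhs_def a_def by linarith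
        qed
        then have "rhs x * u x \<le> (\<bar>lam\<bar> * ((U + a) / ?n) + \<bar>real DIM('a) - 2 + 2 * \<rho>\<bar> * (a / ?n)) * u x"
          using u_pos[OF x(1)] by (intro mult_right_mono) auto
        also have "\<dots> = \<bar>lam\<bar> * U\<^sup>2 + L * (a * U)"
          using n by (simp add: U_def L_def power2_eq_square field_simps)
        finally show ?thesis .
      qed
      have "g x = (\<zeta> x)\<^sup>2 * (rhs x * u x) - f x - 2 * \<zeta> x * u x * (grad u x \<bullet> D\<zeta> x)"
        by (simp add: g_def \<phi>_def D\<phi>_def f_def inner_add_right power_mult_distrib power2_norm_eq_inner algebra_simps)
      moreover have "(\<zeta> x)\<^sup>2 * (rhs x * u x) \<le> (\<zeta> x)\<^sup>2 * (\<bar>lam\<bar> * U\<^sup>2 + L * (a * U))"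
        using rhs_u by (intro mult_left_mono) auto
      moreover have "(\<zeta> x)\<^sup>2 * (\<bar>lam\<bar> * U\<^sup>2 + L * (a * U)) \<le> \<bar>lam\<bar> * (U * p)\<^sup>2 + L * ((\<zeta> x * a) * (U * p))"
      proof -
        have "(\<zeta> x * U)\<^sup>2 \<le> (U * p)\<^sup>2"
          using zp z U by (intro power_mono) (auto simp: mult.commute[of _ U] intro: mult_left_mono)
        moreover have "(\<zeta> x * a) * (\<zeta> x * U) \<le> (\<zeta> x * a) * (U * p)"
          using zp z U a by (intro mult_left_mono) (auto simp: mult.commute[of _ U] intro: mult_left_mono)
        ultimately have "\<bar>lam\<bar> * (\<zeta> x * U)\<^sup>2 + L * ((\<zeta> x * a) * (\<zeta> x * U)) \<le> \<bar>lam\<bar> * (U * p)\<^sup>2 + L * ((\<zeta> x * a) * (U * p))"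
          using L by (intro add_mono mult_left_mono[where c = "\<bar>lam\<bar>"] mult_left_mono[where c = L]) auto
        then show ?thesis
          by (simp add: power2_eq_square algebra_simps)
      qed
      moreover have "- (2 * \<zeta> x * u x * (grad u x \<bullet> D\<zeta> x)) \<le> 20 * ((\<zeta> x * a) * (U * p))"
      proof -
        have "- (grad u x \<bullet> D\<zeta> x) \<le> a * norm (D\<zeta> x)"
          using Cauchy_Schwarz_ineq2[of "grad u x" "D\<zeta> x"] unfolding a_def by linarith
        then have "(2 * \<zeta> x * u x) * (- (grad u x \<bullet> D\<zeta> x)) \<le> (2 * \<zeta> x * u x) * (a * norm (D\<zeta> x))"
          using z u_pos[OF x(1)] by (intro mult_left_mono) auto
        also have "\<dots> = (2 * (\<zeta> x * a) * U) * (?n * norm (D\<zeta> x))"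
          using n by (simp add: U_def)
        also have "\<dots> \<le> (2 * (\<zeta> x * a) * U) * (10 * p)"
          using z a U Dzp by (intro mult_left_mono) auto
        also have "\<dots> = 20 * ((\<zeta> x * a) * (U * p))"
          by algebra
        finally show ?thesis
          unfolding mult_minus_right .
      qed
      moreover have "f x = (\<zeta> x * a)\<^sup>2"
        by (simp add: f_def a_def)
      ultimately have "f x / 2 + g x \<le> \<bar>lam\<bar> * (U * p)\<^sup>2 + (L * ((\<zeta> x * a) * (U * p)) + 20 * ((\<zeta> x * a) * (U * p)))
          - (\<zeta> x * a)\<^sup>2 / 2"
        by linarith
      also have "\<dots> \<le> (\<bar>lam\<bar> + (L + 20)\<^sup>2 / 2) * (U * p)\<^sup>2"
      proof -
        have "l * y\<^sup>2 + (L * (s * y) + 20 * (s * y)) - s\<^sup>2 / 2 \<le> (l + (L + 20)\<^sup>2 / 2) * y\<^sup>2" for l s y :: real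
          using zero_le_power2[of "(L + 20) * y - s"] by (simp add: power2_eq_square field_simps)
        then show ?thesis
          by blast
      qed
      also have "\<dots> \<le> (\<bar>lam\<bar> + (L + 20)\<^sup>2 / 2) * (C\<^sup>2 * ?n powr (\<gamma> - 2))"
        using Up by (intro mult_left_mono) auto
      finally show ?thesis
        by (simp add: A_def)
    qed
    have A: "0 \<le> A"
      by (simp add: A_def)
    have "(LINT x:?V|lborel. f x / 2 + g x) \<le> (LINT x:cball (0::'a) R|lborel. A * norm x powr (\<gamma> - 2))"
      unfolding set_lebesgue_integral_def
    proof (rule integral_mono)
      show "integrable lborel (\<lambda>x. indicator ?V x *\<^sub>R (f x / 2 + g x))"
        using f g by (simp add: set_integrable_def distrib_left)
      show "integrable lborel (\<lambda>x::'a. indicator (cball 0 R) x *\<^sub>R (A * norm x powr (\<gamma> - 2)))"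
        using int_powr unfolding set_integrable_def by (simp add: mult.left_commute)
      show "indicator ?V x *\<^sub>R (f x / 2 + g x) \<le> indicator (cball 0 R) x *\<^sub>R (A * norm x powr (\<gamma> - 2))" for x
        using key[of x] \<zeta>0[of x] A by (cases "norm x \<le> R"; cases "x \<in> ?V")
          (auto simp: f_def g_def \<phi>_def D\<phi>_def K_def)
    qed
    moreover have "(LINT x:?V|lborel. f x / 2 + g x) = (LINT x:?V|lborel. f x) / 2"
      using f g g0 by (simp add: set_integral_add)
    ultimately have le: "(LINT x:?V|lborel. f x) \<le> M"
      by (simp add: M_def)
    \<comment> \<open>Off \<open>K\<close> the cutoffs vanish or \<open>x\<close> is 0, where
      \<open>norm x powr (- \<gamma>)\<close> is 0; so the integrand on the whole space needs no
      indicator, although \<open>grad u\<close> is unspecified outside the punctured domain.\<close>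
    have eq: "indicator ?V x *\<^sub>R f x = (inner_cutoff e (x \<bullet> x) * outer_cutoff (R\<^sup>2) (x \<bullet> x))\<^sup>2
        * (norm x powr (- \<gamma>) * (norm (grad u x))\<^sup>2)" for x
    proof (cases "x \<in> K")
      case True
      then have "x \<in> ?V" "x \<noteq> 0"
        using K(2) by auto
      then have "((x \<bullet> x) powr (- \<gamma> / 4))\<^sup>2 = norm x powr (- \<gamma>)"
        by (simp add: powr_powr flip: power2_norm_eq_inner powr_numeral)
      with \<open>x \<in> ?V\<close> show ?thesis
        by (simp add: f_def \<zeta>_def k_def power_mult_distrib)
    next
      case False
      then have "inner_cutoff e (x \<bullet> x) * outer_cutoff (R\<^sup>2) (x \<bullet> x) = 0 \<or> x = 0"
        using \<zeta>0[OF False] by (auto simp: \<zeta>_def k_def)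
      then show ?thesis
        using \<zeta>0[OF False] by (auto simp: f_def)
    qed
    show ?thesis
      using f le unfolding set_integrable_def set_lebesgue_integral_def eq by blast
  qed
  then show thesis
    using that by blast
qed

end

subsection \<open>Removing the singularity\<close>

lemma L1_loc_D: "f \<in> L1_loc V \<Longrightarrow> compact K \<Longrightarrow> K \<subseteq> V \<Longrightarrow> set_integrable lborel K f"
  by (simp add: L1_loc_def)

lemma C1_c_if_Cinf_c: "\<phi> \<in> Cinf_c V \<Longrightarrow> \<phi> \<in> C1_c V"
  by (simp add: Cinf_c_def C1_c_def del: Ck_on.simps One_nat_def)

lemma partial_derivative_Cinf_c:
  fixes \<phi> :: "'a::euclidean_space \<Rightarrow> real"
  assumes "\<phi> \<in> Cinf_c V" "b \<in> Basis"
  shows "(\<lambda>x. grad \<phi> x \<bullet> b) \<in> C1_c V"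
proof -
  have "Ck_on (Suc 1) UNIV \<phi>"
    using assms(1) by (auto simp: Cinf_c_def simp del: Ck_on.simps)
  then have 1: "Ck_on 1 UNIV (\<lambda>x. grad \<phi> x \<bullet> b)"
    using assms(2) unfolding Ck_on.simps(2) by blast
  have \<phi>: "compactly_supported_in V \<phi>"
    using assms(1) by (simp add: Cinf_c_def)
  have "grad \<phi> x = 0" if "x \<notin> closure {x. \<phi> x \<noteq> 0}" for x
    using that by (intro grad_eq GDERIV_zero_outside[where K = "closure {x. \<phi> x \<noteq> 0}"])
      (use closure_subset[of "{x. \<phi> x \<noteq> 0}"] in auto)
  then have "{x. grad \<phi> x \<bullet> b \<noteq> 0} \<subseteq> closure {x. \<phi> x \<noteq> 0}"
    by force
  then have sub: "closure {x. grad \<phi> x \<bullet> b \<noteq> 0} \<subseteq> closure {x. \<phi> x \<noteq> 0}"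
    by (intro closure_minimal closed_closure)
  have "compactly_supported_in V (\<lambda>x. grad \<phi> x \<bullet> b)"
    unfolding compactly_supported_in_def
  proof
    show "compact (closure {x. grad \<phi> x \<bullet> b \<noteq> 0})"
      using compact_Int_closed[of "closure {x. \<phi> x \<noteq> 0}" "closure {x. grad \<phi> x \<bullet> b \<noteq> 0}"] \<phi> sub
      by (simp add: compactly_supported_in_def Int_absorb1)
    show "closure {x. grad \<phi> x \<bullet> b \<noteq> 0} \<subseteq> V"
      using \<phi> sub by (auto simp: compactly_supported_in_def)
  qed
  with 1 show ?thesis
    by (simp add: C1_c_def)
qed

lemma set_integrable_L1_loc_mult:
  fixes h \<psi> :: "'a::euclidean_space \<Rightarrow> real"
  assumes "h \<in> L1_loc V" "compact K" "K \<subseteq> V" "continuous_on UNIV \<psi>" "\<And>x. x \<notin> K \<Longrightarrow> \<psi> x = 0"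
  shows "set_integrable lborel V (\<lambda>x. h x * \<psi> x)"
proof -
  have "bounded (\<psi> ` K)"
    using assms(2,4) by (meson compact_continuous_image compact_imp_bounded continuous_on_subset subset_UNIV)
  then obtain M where M: "\<And>x. x \<in> K \<Longrightarrow> \<bar>\<psi> x\<bar> \<le> M"
    unfolding bounded_iff by auto
  have int: "integrable lborel (\<lambda>x. indicator K x *\<^sub>R h x)"
    using L1_loc_D[OF assms(1-3)] by (simp add: set_integrable_def)
  have "integrable lborel (\<lambda>x. (indicator K x *\<^sub>R h x) * \<psi> x)"
  proof (rule Bochner_Integration.integrable_bound)
    show "integrable lborel (\<lambda>x. M * (indicator K x *\<^sub>R h x))"
      using int by (rule integrable_mult_right)
    show "(\<lambda>x. (indicator K x *\<^sub>R h x) * \<psi> x) \<in> borel_measurable lborel"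
      using int borel_measurable_continuous_onI[OF assms(4)] by (intro borel_measurable_times) auto
    show "AE x in lborel. norm ((indicator K x *\<^sub>R h x) * \<psi> x) \<le> norm (M * (indicator K x *\<^sub>R h x))"
    proof (rule AE_I2)
      fix x
      have "\<bar>h x\<bar> * \<bar>\<psi> x\<bar> \<le> \<bar>h x\<bar> * \<bar>M\<bar>" if "x \<in> K"
        using M[OF that] by (intro mult_left_mono) auto
      then show "norm ((indicator K x *\<^sub>R h x) * \<psi> x) \<le> norm (M * (indicator K x *\<^sub>R h x))"
        by (cases "x \<in> K") (auto simp: abs_mult mult.commute)
    qed
  qed
  moreover have "(\<lambda>x. (indicator K x *\<^sub>R h x) * \<psi> x) = (\<lambda>x. indicator V x *\<^sub>R (h x * \<psi> x))"
    using assms(3,5) by (auto simp: indicator_def fun_eq_iff)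
  ultimately show ?thesis
    by (simp add: set_integrable_def)
qed

lemma set_integrable_L1_loc_mult_C1_c:
  fixes h \<psi> :: "'a::euclidean_space \<Rightarrow> real"
  assumes "h \<in> L1_loc V" "\<psi> \<in> C1_c V"
  shows "set_integrable lborel V (\<lambda>x. h x * \<psi> x)"
    and "set_integrable lborel V (\<lambda>x. h x * (grad \<psi> x \<bullet> b))"
proof -
  obtain K where K: "compact K" "K \<subseteq> V" and 0: "\<And>x. x \<notin> K \<Longrightarrow> \<psi> x = 0" "\<And>x. x \<notin> K \<Longrightarrow> grad \<psi> x = 0"
    and c: "continuous_on UNIV (grad \<psi>)" "continuous_on UNIV \<psi>"
    using C1_cE[OF assms(2)] by metis
  show "set_integrable lborel V (\<lambda>x. h x * \<psi> x)"
    by (rule set_integrable_L1_loc_mult[OF assms(1) K c(2) 0(1)])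
  show "set_integrable lborel V (\<lambda>x. h x * (grad \<psi> x \<bullet> b))"
    using 0 by (intro set_integrable_L1_loc_mult[OF assms(1) K] continuous_intros c) auto
qed

text \<open>The value of \<open>h\<close> at the origin may be arbitrary, as for the gradient of
  \<open>u\<close>; the single point is split off.\<close>

lemma borel_measurable_punctured:
  fixes h :: "'a::euclidean_space \<Rightarrow> real"
  assumes "continuous_on (\<Omega> - {0}) h" "A \<in> sets borel" "A \<subseteq> \<Omega>"
  shows "(\<lambda>x. indicator A x *\<^sub>R h x) \<in> borel_measurable lborel"
proof -
  have "continuous_on (A - {0}) h"
    using assms(1,3) by (meson Diff_mono continuous_on_subset order_refl)
  then have "(\<lambda>x. indicator (A - {0}) x *\<^sub>R h x) \<in> borel_measurable borel"
    using assms(2) by (intro borel_measurable_continuous_on_indicator) auto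
  then have "(\<lambda>x. indicator (A - {0}) x *\<^sub>R h x + indicator (A \<inter> {0}) x *\<^sub>R h 0) \<in> borel_measurable lborel"
    using assms(2) by (intro borel_measurable_add) auto
  moreover have "(\<lambda>x. indicator A x *\<^sub>R h x)
      = (\<lambda>x. indicator (A - {0}) x *\<^sub>R h x + indicator (A \<inter> {0}) x *\<^sub>R h 0)"
    by (auto simp: indicator_def fun_eq_iff)
  ultimately show ?thesis
    by simp
qed

lemma set_integrable_punctured_bound:
  fixes h g :: "'a::euclidean_space \<Rightarrow> real"
  assumes "continuous_on (\<Omega> - {0}) h" "A \<in> sets borel" "A \<subseteq> \<Omega>"
    and "set_integrable lborel A g" "\<And>x. x \<in> A \<Longrightarrow> x \<noteq> 0 \<Longrightarrow> \<bar>h x\<bar> \<le> g x"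
  shows "set_integrable lborel A h"
  unfolding set_integrable_def
proof (rule Bochner_Integration.integrable_bound[OF assms(4)[unfolded set_integrable_def]])
  show "(\<lambda>x. indicator A x *\<^sub>R h x) \<in> borel_measurable lborel"
    using assms by (intro borel_measurable_punctured)
  show "AE x in lborel. norm (indicator A x *\<^sub>R h x) \<le> norm (indicator A x *\<^sub>R g x)"
    using AE_lborel_singleton[of 0]
    by eventually_elim (use assms(5) in \<open>fastforce simp: indicator_def\<close>)
qed

text \<open>A bound is needed near the origin only: a compact set minus an open ball about 0 is
  compact in the region where \<open>h\<close> is continuous.\<close>

lemma L1_loc_punctured:
  fixes h :: "'a::euclidean_space \<Rightarrow> real"
  assumes "continuous_on (\<Omega> - {0}) h" "0 < r" "cball 0 r \<subseteq> \<Omega>"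
    and "set_integrable lborel (cball 0 r) g" "\<And>x. 0 < norm x \<Longrightarrow> norm x \<le> r \<Longrightarrow> \<bar>h x\<bar> \<le> g x"
  shows "h \<in> L1_loc \<Omega>"
  unfolding L1_loc_def
proof safe
  fix K assume K: "compact K" "K \<subseteq> \<Omega>"
  have "set_integrable lborel (cball 0 r) h"
    by (rule set_integrable_punctured_bound[OF assms(1) _ assms(3,4)]) (use assms(5) in auto)
  then have 1: "set_integrable lborel (K \<inter> cball 0 r) h"
  proof (rule set_integrable_subset)
    show "K \<inter> cball 0 r \<in> sets lborel"
      using borel_compact[OF K(1)] by simp
  qed simp
  have "compact (K - ball 0 r)" "K - ball 0 r \<subseteq> \<Omega> - {0}"
    using K assms(2) by (auto intro: compact_diff)
  then have 2: "set_integrable lborel (K - ball 0 r) h"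
    using assms(1) by (intro set_integrable_zero_outside_compact[of "K - ball 0 r"]) (auto intro: continuous_on_subset)
  have "set_integrable lborel ((K \<inter> cball 0 r) \<union> (K - ball 0 r)) h"
  proof (rule set_integrable_Un[OF 1 2])
    show "K \<inter> cball 0 r \<in> sets lborel" "K - ball 0 r \<in> sets lborel"
      using borel_compact[OF K(1)] by simp_all
  qed
  moreover have "(K \<inter> cball 0 r) \<union> (K - ball 0 r) = K"
    by auto
  ultimately show "set_integrable lborel K h"
    by simp
qed

lemma inner_cutoff_tendsto_1:
  assumes "0 < s"
  shows "(\<lambda>n. inner_cutoff (1 / real (Suc n)) s) \<longlonglongrightarrow> 1"
    and "(\<lambda>n. inner_cutoff' (1 / real (Suc n)) s) \<longlonglongrightarrow> 0"
proof -
  have 0: "(\<lambda>n. 1 / real (Suc n)) \<longlonglongrightarrow> 0"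
    using LIMSEQ_inverse_real_of_nat by (simp add: inverse_eq_divide)
  have "(\<lambda>n. (max 0 (1 - 1 / real (Suc n) / s))\<^sup>2) \<longlonglongrightarrow> (max 0 (1 - 0 / s))\<^sup>2"
    using assms by (intro tendsto_intros 0) auto
  then show "(\<lambda>n. inner_cutoff (1 / real (Suc n)) s) \<longlonglongrightarrow> 1"
    using assms by (simp add: inner_cutoff_def)
  have "(\<lambda>n. 2 * max 0 (1 - 1 / real (Suc n) / s) * (1 / real (Suc n) / s\<^sup>2))
      \<longlonglongrightarrow> 2 * max 0 (1 - 0 / s) * (0 / s\<^sup>2)"
    using assms by (intro tendsto_intros 0) auto
  then show "(\<lambda>n. inner_cutoff' (1 / real (Suc n)) s) \<longlonglongrightarrow> 0"
    by (simp add: inner_cutoff'_def)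
qed

text \<open>The equation is \<open>div Q = P\<close>, tested first away from the origin.\<close>

lemma divergence_equation_removable:
  fixes P :: "'a::euclidean_space \<Rightarrow> real" and Q :: "'a \<Rightarrow> 'a"
  assumes "open \<Omega>"
    and cP: "continuous_on (\<Omega> - {0}) P" and cQ: "continuous_on (\<Omega> - {0}) Q"
    and P: "P \<in> L1_loc \<Omega>" and Q: "(\<lambda>x. norm (Q x) / norm x) \<in> L1_loc \<Omega>"
    and weak: "\<And>\<phi>. \<phi> \<in> C1_c (\<Omega> - {0}) \<Longrightarrow> (LINT x:\<Omega> - {0}|lborel. P x * \<phi> x + Q x \<bullet> grad \<phi> x) = 0"
    and \<phi>: "\<phi> \<in> C1_c \<Omega>"
  shows "(LINT x:\<Omega>|lborel. P x * \<phi> x + Q x \<bullet> grad \<phi> x) = 0"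
proof -
  let ?V = "\<Omega> - {0}"
  have V: "open ?V"
    using \<open>open \<Omega>\<close> by auto
  obtain K where K: "compact K" "K \<subseteq> \<Omega>" and 0: "\<And>x. x \<notin> K \<Longrightarrow> \<phi> x = 0" "\<And>x. x \<notin> K \<Longrightarrow> grad \<phi> x = 0"
    and D\<phi>: "\<And>x. GDERIV \<phi> x :> grad \<phi> x" and c\<phi>: "continuous_on UNIV (grad \<phi>)" "continuous_on UNIV \<phi>"
    using C1_cE[OF \<phi>] by metis
  have "bounded (\<phi> ` K)" "bounded (grad \<phi> ` K)" "bounded K"
    using K(1) c\<phi> by (meson compact_continuous_image compact_imp_bounded continuous_on_subset subset_UNIV)+
  then obtain M\<^sub>1 M\<^sub>2 B where M12: "\<And>x. x \<in> K \<Longrightarrow> \<bar>\<phi> x\<bar> \<le> M\<^sub>1" "\<And>x. x \<in> K \<Longrightarrow> norm (grad \<phi> x) \<le> M\<^sub>2"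
    and B: "\<And>x. x \<in> K \<Longrightarrow> norm x \<le> B"
    unfolding bounded_iff ball_simps real_norm_def by metis
  define M where "M = max 0 (max M\<^sub>1 M\<^sub>2)"
  have M: "0 \<le> M" "\<And>x. x \<in> K \<Longrightarrow> \<bar>\<phi> x\<bar> \<le> M" "\<And>x. x \<in> K \<Longrightarrow> norm (grad \<phi> x) \<le> M"
    using M12 by (force simp: M_def)+
  define e where "e n = 1 / real (Suc n)" for n
  have e: "0 < e n" for n
    by (simp add: e_def)
  define \<eta> where "\<eta> n x = inner_cutoff (e n) (x \<bullet> x)" for n and x :: 'a
  define D\<eta> where "D\<eta> n x = (2 * inner_cutoff' (e n) (x \<bullet> x)) *\<^sub>R x" for n and x :: 'a
  have \<eta>: "GDERIV (\<eta> n) x :> D\<eta> n x" if "x \<noteq> 0" for n x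
    unfolding \<eta>_def D\<eta>_def using that by (intro GDERIV_radial inner_cutoff_DERIV) auto
  have \<eta>_range: "0 \<le> \<eta> n x" "\<eta> n x \<le> 1" for n x
    using inner_cutoff_range[OF e] by (auto simp: \<eta>_def)
  \<comment> \<open>Uniform in \<open>n\<close>, whereas for fixed nonzero \<open>x\<close> the
    gradients tend to 0. Integrability of |Q| / |x| is thus exactly what dominates the term in which
    \<open>Q\<close> meets the gradient of the cutoff.\<close>
  have D\<eta>_bound: "norm (D\<eta> n x) \<le> 4 / norm x" if "x \<noteq> 0" for n x
    using inner_cutoff'_bound[OF e, of "x \<bullet> x" n] that
    by (simp add: D\<eta>_def pos_le_divide_eq power2_eq_square mult.commute flip: power2_norm_eq_inner)
  have cD\<eta>: "continuous_on ?V (D\<eta> n)" for n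
    unfolding D\<eta>_def by (intro continuous_intros continuous_on_compose2[OF inner_cutoff'_continuous]) auto
  have c\<eta>: "continuous_on ?V (\<eta> n)" for n
    using \<eta> by (intro GDERIV_continuous_on) auto
  define E where "E n x = \<phi> x *\<^sub>R D\<eta> n x + \<eta> n x *\<^sub>R grad \<phi> x" for n x
  define F where "F n x = P x * (\<phi> x * \<eta> n x) + Q x \<bullet> E n x" for n x
  have E: "GDERIV (\<lambda>x. \<phi> x * \<eta> n x) x :> E n x" if "x \<noteq> 0" for n x
    unfolding E_def using GDERIV_mult[OF D\<phi> \<eta>[OF that]] .
  have c\<phi>V: "continuous_on ?V (grad \<phi>)" "continuous_on ?V \<phi>"
    using c\<phi> continuous_on_subset by blast+
  have cE: "continuous_on ?V (E n)" for n
    unfolding E_def by (intro continuous_intros cD\<eta> c\<eta> c\<phi>V)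
  have C1: "(\<lambda>x. \<phi> x * \<eta> n x) \<in> C1_c ?V" for n
  proof (rule C1_cI[OF V _ _ E cE])
    have "closed {x::'a. e n \<le> x \<bullet> x}"
      by (intro closed_Collect_le continuous_intros)
    then show "compact (K \<inter> {x. e n \<le> x \<bullet> x})"
      using K(1) by (rule compact_Int_closed[rotated])
    show "K \<inter> {x. e n \<le> x \<bullet> x} \<subseteq> ?V"
      using K(2) e[of n] by auto
    show "\<phi> x * \<eta> n x = 0" if "x \<notin> K \<inter> {x. e n \<le> x \<bullet> x}" for x
      using that 0(1)[of x] inner_cutoff_eq_0[OF e, of "x \<bullet> x" n] by (auto simp: \<eta>_def)
  qed auto
  have F0: "(LINT x:?V|lborel. F n x) = 0" for n
  proof -
    have "(LINT x:?V|lborel. F n x) = (LINT x:?V|lborel. P x * (\<phi> x * \<eta> n x) + Q x \<bullet> grad (\<lambda>x. \<phi> x * \<eta> n x) x)"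
      using V by (intro set_lebesgue_integral_cong) (auto simp: F_def grad_eq[OF E])
    then show ?thesis
      using weak[OF C1] by simp
  qed
  have cF: "continuous_on ?V (F n)" for n
    unfolding F_def by (intro continuous_intros cP cQ cE c\<eta> c\<phi>V)
  have cL: "continuous_on ?V (\<lambda>x. P x * \<phi> x + Q x \<bullet> grad \<phi> x)"
    by (intro continuous_intros cP cQ c\<phi>V)
  \<comment> \<open>The part \<open>4 * M\<close> belongs to the gradient of the cutoff. The part
    \<open>M * B\<close> belongs to the gradient of \<phi>: on \<open>K\<close> one has |Q| <= B |Q|
    / |x|, so |Q| itself needs no separate hypothesis.\<close>
  let ?g = "\<lambda>x. M * \<bar>P x\<bar> + (M * B + 4 * M) * (norm (Q x) / norm x)"
  have g: "set_integrable lborel K ?g"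
    using L1_loc_D[OF P K] L1_loc_D[OF Q K]
    by (intro set_integral_add set_integrable_mult_right set_integrable_abs) auto
  have bound: "\<bar>F n x\<bar> \<le> ?g x" if "x \<in> K" "x \<noteq> 0" for n x
  proof -
    have 1: "\<bar>P x * (\<phi> x * \<eta> n x)\<bar> \<le> \<bar>P x\<bar> * (M * 1)"
      unfolding abs_mult using M \<eta>_range that by (intro mult_mono) auto
    have "norm (E n x) \<le> M * (4 / norm x) + 1 * M"
    proof -
      have "norm (E n x) \<le> \<bar>\<phi> x\<bar> * norm (D\<eta> n x) + \<eta> n x * norm (grad \<phi> x)"
        using norm_triangle_ineq[of "\<phi> x *\<^sub>R D\<eta> n x" "\<eta> n x *\<^sub>R grad \<phi> x"] \<eta>_range(1)[of n x] by (simp add: E_def)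
      also have "\<dots> \<le> M * (4 / norm x) + 1 * M"
        using M \<eta>_range D\<eta>_bound that by (intro add_mono mult_mono) auto
      finally show ?thesis .
    qed
    then have "\<bar>Q x \<bullet> E n x\<bar> \<le> norm (Q x) * (M * (4 / norm x) + 1 * M)"
      by (intro order_trans[OF Cauchy_Schwarz_ineq2] mult_left_mono) auto
    also have "\<dots> = (4 * M + M * norm x) * (norm (Q x) / norm x)"
      using that by (simp add: field_simps)
    also have "\<dots> \<le> (M * B + 4 * M) * (norm (Q x) / norm x)"
      using B[OF that(1)] M(1) by (intro mult_right_mono) (auto simp: mult_left_mono)
    finally have 2: "\<bar>Q x \<bullet> E n x\<bar> \<le> (M * B + 4 * M) * (norm (Q x) / norm x)" .
    show ?thesis
      unfolding F_def using order_trans[OF abs_triangle_ineq add_mono[OF 1 2]] by (simp add: mult.commute)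
  qed
  have "(\<lambda>n. LINT x|lborel. indicator ?V x *\<^sub>R F n x)
      \<longlonglongrightarrow> (LINT x|lborel. indicator \<Omega> x *\<^sub>R (P x * \<phi> x + Q x \<bullet> grad \<phi> x))"
  proof (rule integral_dominated_convergence)
    show "(\<lambda>x. indicator \<Omega> x *\<^sub>R (P x * \<phi> x + Q x \<bullet> grad \<phi> x)) \<in> borel_measurable lborel"
      using \<open>open \<Omega>\<close> by (intro borel_measurable_punctured[OF cL]) auto
    show "(\<lambda>x. indicator ?V x *\<^sub>R F n x) \<in> borel_measurable lborel" for n
      using \<open>open \<Omega>\<close> by (intro borel_measurable_punctured[OF cF]) auto
    show "integrable lborel (\<lambda>x. indicator K x *\<^sub>R ?g x)"
      using g by (simp add: set_integrable_def)
    show "AE x in lborel. (\<lambda>n. indicator ?V x *\<^sub>R F n x) \<longlonglongrightarrow> indicator \<Omega> x *\<^sub>R (P x * \<phi> x + Q x \<bullet> grad \<phi> x)"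
      using AE_lborel_singleton[of 0]
    proof eventually_elim
      fix x :: 'a assume x: "x \<noteq> 0"
      have "(\<lambda>n. \<eta> n x) \<longlonglongrightarrow> 1" "(\<lambda>n. D\<eta> n x) \<longlonglongrightarrow> (2 * 0) *\<^sub>R x"
        unfolding \<eta>_def D\<eta>_def e_def using x by (intro tendsto_intros inner_cutoff_tendsto_1; simp)+
      then have "(\<lambda>n. F n x) \<longlonglongrightarrow> P x * (\<phi> x * 1) + Q x \<bullet> (\<phi> x *\<^sub>R ((2 * 0) *\<^sub>R x) + 1 *\<^sub>R grad \<phi> x)"
        unfolding F_def E_def by (intro tendsto_intros)
      then have "(\<lambda>n. F n x) \<longlonglongrightarrow> P x * \<phi> x + Q x \<bullet> grad \<phi> x"
        by simp
      then have "(\<lambda>n. indicator \<Omega> x *\<^sub>R F n x) \<longlonglongrightarrow> indicator \<Omega> x *\<^sub>R (P x * \<phi> x + Q x \<bullet> grad \<phi> x)"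
        by (intro tendsto_scaleR tendsto_const)
      then show "(\<lambda>n. indicator ?V x *\<^sub>R F n x) \<longlonglongrightarrow> indicator \<Omega> x *\<^sub>R (P x * \<phi> x + Q x \<bullet> grad \<phi> x)"
        using x by (simp add: indicator_def)
    qed
    show "AE x in lborel. norm (indicator ?V x *\<^sub>R F n x) \<le> indicator K x *\<^sub>R ?g x" for n
      using AE_lborel_singleton[of 0]
    proof eventually_elim
      fix x :: 'a assume x: "x \<noteq> 0"
      show "norm (indicator ?V x *\<^sub>R F n x) \<le> indicator K x *\<^sub>R ?g x"
      proof (cases "x \<in> K")
        case True
        then show ?thesis
          using bound[OF True x, of n] K(2) x by auto
      next
        case False
        then show ?thesis
          by (simp add: F_def E_def 0)
      qed
    qed
  qed
  then show ?thesis
    using F0 by (simp add: set_lebesgue_integral_def LIMSEQ_const_iff)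
qed

section \<open>Integrability of the terms and the equation across the origin\<close>

context positive_solution_near_0
begin

text \<open>Near the origin each function is at most a multiple of \<open>E + P\<close>, where
  \<open>E\<close> is the weighted energy density and \<open>P\<close> the power \<gamma> - 2 of the
  norm. Fatou's lemma makes \<open>E\<close> integrable once the inner cutoff is removed.\<close>

lemma L1_loc_terms:
  shows "u \<in> L1_loc \<Omega>" "(\<lambda>x. (u x)\<^sup>2) \<in> L1_loc \<Omega>" "(\<lambda>x. u x / norm x) \<in> L1_loc \<Omega>"
    "(\<lambda>x. norm (grad u x) / norm x) \<in> L1_loc \<Omega>" "(\<lambda>x. (norm (grad u x))\<^sup>2) \<in> L1_loc \<Omega>"
    "drift \<rho> u \<in> L1_loc \<Omega>" "(\<lambda>x. G \<tau> x (u x) (grad u x)) \<in> L1_loc \<Omega>"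
    "(\<lambda>x. norm x powr \<theta> * u x powr q) \<in> L1_loc \<Omega>"
proof -
  obtain R \<gamma> C where R: "0 < R" "R \<le> 1" "cball 0 R \<subseteq> \<Omega>" and \<gamma>: "0 < \<gamma>" "\<gamma> \<le> 1" and C: "0 < C"
    and decays: "\<forall>x\<in>cball (0::'a) R - {0}. u x \<le> C * norm x powr \<gamma>
      \<and> norm x powr \<theta> * u x powr q \<le> C * norm x powr (\<gamma> - 2)"
    by (rule decay_near_0)
  have decay: "u x \<le> C * norm x powr \<gamma>" "norm x powr \<theta> * u x powr q \<le> C * norm x powr (\<gamma> - 2)"
    if "0 < norm x" "norm x \<le> R" for x
    using decays that by auto
  define E where "E x = norm x powr (- \<gamma>) * (norm (grad u x))\<^sup>2" for x
  define P where "P x = norm x powr (\<gamma> - 2)" for x :: 'a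
  let ?f = "\<lambda>n x. (inner_cutoff (1 / real (Suc n)) (x \<bullet> x) * outer_cutoff (R\<^sup>2) (x \<bullet> x))\<^sup>2 * E x"
  obtain M where M: "\<forall>e>0.
      integrable lborel (\<lambda>x. (inner_cutoff e (x \<bullet> x) * outer_cutoff (R\<^sup>2) (x \<bullet> x))\<^sup>2
        * (norm x powr (- \<gamma>) * (norm (grad u x))\<^sup>2)) \<and>
      (LINT x|lborel. (inner_cutoff e (x \<bullet> x) * outer_cutoff (R\<^sup>2) (x \<bullet> x))\<^sup>2
        * (norm x powr (- \<gamma>) * (norm (grad u x))\<^sup>2)) \<le> M"
    by (rule weighted_energy_bound[OF R(1,3) \<gamma> less_imp_le[OF C] decay(1)])
  then have int: "integrable lborel (?f n)" and le: "(LINT x|lborel. ?f n x) \<le> M" for n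
    unfolding E_def by simp_all
  \<comment> \<open>At the origin the inner cutoffs are 0 and do not tend to 1, but
    \<open>E 0\<close> is 0 since \<open>0 powr (- \<gamma>)\<close> is 0, so convergence holds
    everywhere.\<close>
  have lim: "(\<lambda>n. ?f n x) \<longlonglongrightarrow> (outer_cutoff (R\<^sup>2) (x \<bullet> x))\<^sup>2 * E x" for x
  proof (cases "x = 0")
    case False
    then have "(\<lambda>n. ?f n x) \<longlonglongrightarrow> (1 * outer_cutoff (R\<^sup>2) (x \<bullet> x))\<^sup>2 * E x"
      by (intro tendsto_intros inner_cutoff_tendsto_1) simp
    then show ?thesis
      by simp
  qed (simp add: E_def)
  have lim_int: "integrable lborel (\<lambda>x. (outer_cutoff (R\<^sup>2) (x \<bullet> x))\<^sup>2 * E x)"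
  proof (rule integrable_Fatou[OF int _ le lim])
    show "(\<lambda>x. (outer_cutoff (R\<^sup>2) (x \<bullet> x))\<^sup>2 * E x) \<in> borel_measurable lborel"
      by (rule borel_measurable_LIMSEQ_real[OF lim borel_measurable_integrable[OF int]])
  qed (simp add: E_def)
  \<comment> \<open>On the half ball the outer cutoff is at least the square of 3/4, hence it can be
    divided out; this is the origin of the factor 16/9.\<close>
  define r where "r = R / 2"
  have r: "0 < r" "r \<le> 1" "cball 0 r \<subseteq> \<Omega>" "r \<le> R"
    using R by (auto simp: r_def intro!: subsetD[OF R(3)])
  have cE: "continuous_on (\<Omega> - {0}) E"
    unfolding E_def by (intro continuous_intros continuous_grad) auto
  have E: "set_integrable lborel (cball 0 r) E"
  proof (rule set_integrable_punctured_bound[OF cE _ r(3)])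
    have "integrable lborel (\<lambda>x. (16 / 9)\<^sup>2 * ((outer_cutoff (R\<^sup>2) (x \<bullet> x))\<^sup>2 * E x))"
      using lim_int by (rule integrable_mult_right)
    then show "set_integrable lborel (cball 0 r) (\<lambda>x. (16 / 9)\<^sup>2 * ((outer_cutoff (R\<^sup>2) (x \<bullet> x))\<^sup>2 * E x))"
      unfolding set_integrable_def by (intro integrable_mult_indicator) auto
    show "\<bar>E x\<bar> \<le> (16 / 9)\<^sup>2 * ((outer_cutoff (R\<^sup>2) (x \<bullet> x))\<^sup>2 * E x)" if "x \<in> cball 0 r" for x
    proof -
      have "(norm x)\<^sup>2 \<le> (R / 2)\<^sup>2"
        using that by (intro power_mono) (auto simp: r_def)
      then have "x \<bullet> x / R\<^sup>2 \<le> 1 / 4"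
        using R(1) by (simp add: power_divide field_simps flip: power2_norm_eq_inner)
      then have "3 / 4 \<le> 1 - x \<bullet> x / R\<^sup>2"
        by linarith
      then have "3 / 4 \<le> max 0 (1 - x \<bullet> x / R\<^sup>2)"
        by (rule max.coboundedI2)
      then have "(3 / 4)\<^sup>2 \<le> outer_cutoff (R\<^sup>2) (x \<bullet> x)"
        unfolding outer_cutoff_def by (rule power_mono) simp
      then have "((3 / 4)\<^sup>2)\<^sup>2 \<le> (outer_cutoff (R\<^sup>2) (x \<bullet> x))\<^sup>2"
        by (rule power_mono) simp
      then have "1 \<le> (16 / 9)\<^sup>2 * (outer_cutoff (R\<^sup>2) (x \<bullet> x))\<^sup>2"
        by (simp add: power_divide)
      moreover have "0 \<le> E x"
        by (simp add: E_def)
      ultimately have "1 * E x \<le> ((16 / 9)\<^sup>2 * (outer_cutoff (R\<^sup>2) (x \<bullet> x))\<^sup>2) * E x"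
        by (intro mult_right_mono)
      then show ?thesis
        using \<open>0 \<le> E x\<close> by simp
    qed
  qed auto
  have P: "set_integrable lborel (cball 0 r) P"
    unfolding P_def using \<gamma> dim by (intro set_integrable_norm_powr) auto
  have L1: "h \<in> L1_loc \<Omega>" if "continuous_on (\<Omega> - {0}) h"
    and "\<And>x. 0 < norm x \<Longrightarrow> norm x \<le> r \<Longrightarrow> \<bar>h x\<bar> \<le> A * (E x + P x)" for h A
  proof (rule L1_loc_punctured[OF that(1) r(1,3) _ that(2)])
    show "set_integrable lborel (cball 0 r) (\<lambda>x. A * (E x + P x))"
      by (intro set_integrable_mult_right set_integral_add(1) E P)
  qed
  have PE: "0 \<le> E x" "0 \<le> P x" for x
    by (auto simp: E_def P_def)
  have P_ge: "norm x powr s \<le> P x" if "0 < norm x" "norm x \<le> r" "\<gamma> - 2 \<le> s" for x :: 'a and s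
    unfolding P_def using that r by (intro powr_mono') auto
  have upos: "0 \<le> u x" if "0 < norm x" "norm x \<le> r" for x
    using that r(3) by (intro less_imp_le u_pos) auto
  have u_le: "u x \<le> C * norm x powr \<gamma>" if "0 < norm x" "norm x \<le> r" for x
    using decay(1)[of x] that r by auto
  \<comment> \<open>The values 0, 1 and 2 of \<open>k\<close> serve \<open>u\<close> itself, the
    flux in the integration by parts, and the zero-order part of the bound for
    \<open>G\<close>.\<close>
  have u_div: "\<bar>u x / norm x ^ k\<bar> \<le> C * (E x + P x)" if "0 < norm x" "norm x \<le> r" "k \<le> 2" for x k
  proof -
    have "\<bar>u x / norm x ^ k\<bar> = u x / norm x ^ k"
      using upos[OF that(1,2)] by simp
    also have "\<dots> \<le> (C * norm x powr \<gamma>) / norm x ^ k"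
      using u_le that by (intro divide_right_mono) auto
    also have "\<dots> = C * norm x powr (\<gamma> - real k)"
      using that by (simp add: powr_diff powr_realpow)
    also have "\<dots> \<le> C * (E x + P x)"
      using P_ge[of x "\<gamma> - real k"] that C PE[of x] by (intro mult_left_mono) auto
    finally show ?thesis .
  qed
  have sq: "(norm x powr s)\<^sup>2 = norm x powr (2 * s)" for x :: 'a and s
    by (simp only: power2_eq_square mult_2 powr_add)
  \<comment> \<open>The weight pays off here: 1 / |x| is split into the powers - \<gamma> / 2 and
    \<gamma> / 2 - 1, and a product is at most the sum of squares. The first factor squared,
    together with the gradient, is \<open>E\<close>; the second squared is \<open>P\<close>.\<close>
  have grad_div: "norm (grad u x) / norm x \<le> E x + P x" if "0 < norm x" for x
  proof -
    let ?n = "norm x"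
    have "?n powr (- \<gamma> / 2) * ?n powr (\<gamma> / 2 - 1) = ?n powr (- \<gamma> / 2 + (\<gamma> / 2 - 1))"
      by (rule powr_add[symmetric])
    also have "- \<gamma> / 2 + (\<gamma> / 2 - 1) = - 1"
      by simp
    also have "?n powr (- 1) = 1 / ?n"
      using that by (simp add: powr_minus_divide)
    finally have e: "?n powr (- \<gamma> / 2) * ?n powr (\<gamma> / 2 - 1) = 1 / ?n" .
    have "norm (grad u x) / ?n = (?n powr (- \<gamma> / 2) * ?n powr (\<gamma> / 2 - 1)) * norm (grad u x)"
      unfolding e by simp
    also have "\<dots> = (?n powr (- \<gamma> / 2) * norm (grad u x)) * ?n powr (\<gamma> / 2 - 1)"
      by (simp only: ac_simps)
    also have "\<dots> \<le> (?n powr (- \<gamma> / 2) * norm (grad u x))\<^sup>2 + (?n powr (\<gamma> / 2 - 1))\<^sup>2"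
    proof -
      have *: "a * b \<le> a\<^sup>2 + b\<^sup>2" if "0 \<le> a" "0 \<le> b" for a b :: real
        using sum_squares_bound[of a b] mult_nonneg_nonneg[OF that] by linarith
      show ?thesis
        by (rule *) simp_all
    qed
    also have "\<dots> = E x + P x"
    proof -
      have "2 * (- \<gamma> / 2) = - \<gamma>" "2 * (\<gamma> / 2 - 1) = \<gamma> - 2"
        by auto
      then show ?thesis
        unfolding E_def P_def power_mult_distrib sq by simp
    qed
    finally show ?thesis .
  qed
  show "u \<in> L1_loc \<Omega>"
  proof (rule L1[OF continuous_u])
    show "\<bar>u x\<bar> \<le> C * (E x + P x)" if "0 < norm x" "norm x \<le> r" for x
      using u_div[OF that, of 0] by simp
  qed
  show "(\<lambda>x. (u x)\<^sup>2) \<in> L1_loc \<Omega>"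
  proof (rule L1[of _ "C\<^sup>2"])
    show "\<bar>(u x)\<^sup>2\<bar> \<le> C\<^sup>2 * (E x + P x)" if "0 < norm x" "norm x \<le> r" for x
    proof -
      have "(u x)\<^sup>2 \<le> (C * norm x powr \<gamma>)\<^sup>2"
        using u_le upos that by (intro power_mono) auto
      also have "\<dots> = C\<^sup>2 * norm x powr (2 * \<gamma>)"
        unfolding power_mult_distrib sq ..
      also have "\<dots> \<le> C\<^sup>2 * (E x + P x)"
        using P_ge[of x "2 * \<gamma>"] that \<gamma> PE[of x] by (intro mult_left_mono) auto
      finally show ?thesis
        by simp
    qed
  qed (intro continuous_intros continuous_u)
  show "(\<lambda>x. u x / norm x) \<in> L1_loc \<Omega>"
  proof (rule L1)
    show "continuous_on (\<Omega> - {0}) (\<lambda>x. u x / norm x)"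
      by (intro continuous_intros continuous_u) simp
    show "\<bar>u x / norm x\<bar> \<le> C * (E x + P x)" if "0 < norm x" "norm x \<le> r" for x
      using u_div[OF that, of 1] by simp
  qed
  show grad: "(\<lambda>x. norm (grad u x) / norm x) \<in> L1_loc \<Omega>"
  proof (rule L1)
    show "continuous_on (\<Omega> - {0}) (\<lambda>x. norm (grad u x) / norm x)"
      by (intro continuous_intros continuous_grad) simp
    show "\<bar>norm (grad u x) / norm x\<bar> \<le> 1 * (E x + P x)" if "0 < norm x" for x
      using grad_div[OF that] by simp
  qed
  show "(\<lambda>x. (norm (grad u x))\<^sup>2) \<in> L1_loc \<Omega>"
  proof (rule L1[of _ 1])
    show "\<bar>(norm (grad u x))\<^sup>2\<bar> \<le> 1 * (E x + P x)" if "0 < norm x" "norm x \<le> r" for x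
    proof -
      have "1 \<le> norm x powr (- \<gamma>)"
        using powr_mono'[of "- \<gamma>" 0 "norm x"] that r \<gamma> by simp
      then have "1 * (norm (grad u x))\<^sup>2 \<le> E x"
        unfolding E_def by (intro mult_right_mono) auto
      then show ?thesis
        using PE[of x] by simp
    qed
  qed (intro continuous_intros continuous_grad)
  show "drift \<rho> u \<in> L1_loc \<Omega>"
  proof (rule L1[OF continuous_drift])
    show "\<bar>drift \<rho> u x\<bar> \<le> \<bar>real DIM('a) - 2 + 2 * \<rho>\<bar> * (E x + P x)" if "0 < norm x" for x
      by (rule order_trans[OF abs_drift_le mult_left_mono[OF grad_div[OF that]]]) auto
  qed
  show "(\<lambda>x. G \<tau> x (u x) (grad u x)) \<in> L1_loc \<Omega>"
  proof (rule L1[OF continuous_G])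
    show "\<bar>G \<tau> x (u x) (grad u x)\<bar> \<le> (C + 1) * (E x + P x)" if x: "0 < norm x" "norm x \<le> r" for x
    proof -
      have "G \<tau> x (u x) (grad u x) \<le> u x / norm x ^ 2 + norm (grad u x) / norm x"
        using G_le[OF \<tau> upos[OF x], of x "grad u x"] x by (simp add: add_divide_distrib power2_eq_square)
      also have "\<dots> \<le> \<bar>u x / norm x ^ 2\<bar> + norm (grad u x) / norm x"
        by (rule add_right_mono) (rule abs_ge_self)
      also have "\<dots> \<le> C * (E x + P x) + (E x + P x)"
        by (intro add_mono u_div grad_div x order_refl)
      also have "\<dots> = (C + 1) * (E x + P x)"
        by (simp only: distrib_right mult_1)
      finally show ?thesis
        unfolding abs_of_nonneg[OF G_nonneg] .
    qed
  qed
  show "(\<lambda>x. norm x powr \<theta> * u x powr q) \<in> L1_loc \<Omega>"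
  proof (rule L1[OF continuous_absorption])
    show "\<bar>norm x powr \<theta> * u x powr q\<bar> \<le> C * (E x + P x)" if "0 < norm x" "norm x \<le> r" for x
    proof -
      have "norm x powr \<theta> * u x powr q \<le> C * P x"
        using decay(2)[of x] that r(4) by (simp add: P_def)
      also have "\<dots> \<le> C * (E x + P x)"
        using C PE(1)[of x] by (intro mult_left_mono) auto
      finally show ?thesis
        by simp
    qed
  qed
qed

lemma L1_loc_rhs: "rhs \<in> L1_loc \<Omega>"
  unfolding L1_loc_def rhs_def[abs_def]
proof safe
  fix K assume "compact K" "K \<subseteq> \<Omega>"
  then have "set_integrable lborel K (\<lambda>x. G \<tau> x (u x) (grad u x))" "set_integrable lborel K (drift \<rho> u)"
    "set_integrable lborel K (\<lambda>x. norm x powr \<theta> * u x powr q)"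
    using L1_loc_terms(6-8) L1_loc_D by blast+
  then show "set_integrable lborel K
      (\<lambda>x. lam * G \<tau> x (u x) (grad u x) - drift \<rho> u x - norm x powr \<theta> * u x powr q)"
    by (intro set_integral_diff(1) set_integrable_mult_right)
qed

lemma L1_loc_partial:
  assumes "b \<in> Basis"
  shows "(\<lambda>x. grad u x \<bullet> b) \<in> L1_loc \<Omega>"
  unfolding L1_loc_def
proof safe
  fix K assume K: "compact K" "K \<subseteq> \<Omega>"
  then obtain B where B: "\<And>x. x \<in> K \<Longrightarrow> norm x \<le> B"
    using compact_imp_bounded bounded_iff by metis
  show "set_integrable lborel K (\<lambda>x. grad u x \<bullet> b)"
  proof (rule set_integrable_punctured_bound[OF _ _ K(2)])
    show "set_integrable lborel K (\<lambda>x. B * (norm (grad u x) / norm x))"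
      using L1_loc_D[OF L1_loc_terms(4) K] by (intro set_integrable_mult_right) auto
    show "\<bar>grad u x \<bullet> b\<bar> \<le> B * (norm (grad u x) / norm x)" if "x \<in> K" "x \<noteq> 0" for x
    proof -
      have "\<bar>grad u x \<bullet> b\<bar> \<le> norm (grad u x)"
        using assms by (rule Basis_le_norm)
      also have "\<dots> = norm x * (norm (grad u x) / norm x)"
        using that by simp
      also have "\<dots> \<le> B * (norm (grad u x) / norm x)"
        using B that by (intro mult_right_mono) auto
      finally show ?thesis .
    qed
    show "continuous_on (\<Omega> - {0}) (\<lambda>x. grad u x \<bullet> b)"
      by (intro continuous_intros continuous_grad)
    show "K \<in> sets borel"
      using K(1) by (rule borel_compact)
  qed
qed

text \<open>The removability result with the flux \<open>u x *\<^sub>R b\<close> and its divergence,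
  the partial derivative of \<open>u\<close>. It says that the classical gradient off the origin is
  the weak gradient on the whole domain.\<close>

lemma integration_by_parts_across_0:
  assumes "\<psi> \<in> C1_c \<Omega>" "b \<in> Basis"
  shows "(LINT x:\<Omega>|lborel. (grad u x \<bullet> b) * \<psi> x + u x * (grad \<psi> x \<bullet> b)) = 0"
proof -
  have "(LINT x:\<Omega>|lborel. (grad u x \<bullet> b) * \<psi> x + (u x *\<^sub>R b) \<bullet> grad \<psi> x) = 0"
  proof (rule divergence_equation_removable[OF \<Omega>(1) _ _ L1_loc_partial[OF assms(2)] _ _ assms(1)])
    have eq: "(\<lambda>x. norm (u x *\<^sub>R b) / norm x) = (\<lambda>x. \<bar>u x / norm x\<bar>)"
      using assms(2) by (simp add: norm_Basis fun_eq_iff)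
    show "(\<lambda>x. norm (u x *\<^sub>R b) / norm x) \<in> L1_loc \<Omega>"
      unfolding eq using L1_loc_terms(3) set_integrable_abs unfolding L1_loc_def by blast
    fix \<phi> assume "\<phi> \<in> C1_c (\<Omega> - {0})"
    then have "(LINT x:\<Omega> - {0}|lborel. u x * (grad \<phi> x \<bullet> b) + (grad u x \<bullet> b) * \<phi> x) = 0"
      by (intro integration_by_parts_C1_c open_punctured u_GDERIV continuous_intros continuous_grad)
    then show "(LINT x:\<Omega> - {0}|lborel. (grad u x \<bullet> b) * \<phi> x + (u x *\<^sub>R b) \<bullet> grad \<phi> x) = 0"
      by (simp add: add.commute inner_commute)
  qed (intro continuous_intros continuous_grad continuous_u)+
  then show ?thesis
    by (simp add: inner_commute)
qed

text \<open>The same removability result, now with the flux \<open>- grad u\<close>, whose weak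
  divergence is \<open>rhs\<close>.\<close>

lemma weak_form_across_0:
  assumes "\<phi> \<in> C1_c \<Omega>"
  shows "(LINT x:\<Omega>|lborel. rhs x * \<phi> x - grad u x \<bullet> grad \<phi> x) = 0"
proof -
  have "(LINT x:\<Omega>|lborel. rhs x * \<phi> x + (- grad u x) \<bullet> grad \<phi> x) = 0"
  proof (rule divergence_equation_removable[OF \<Omega>(1) continuous_rhs _ L1_loc_rhs _ _ assms])
    show "(\<lambda>x. norm (- grad u x) / norm x) \<in> L1_loc \<Omega>"
      using L1_loc_terms(4) by simp
    show "(LINT x:\<Omega> - {0}|lborel. rhs x * \<phi> x + (- grad u x) \<bullet> grad \<phi> x) = 0" if "\<phi> \<in> C1_c (\<Omega> - {0})" for \<phi>
      using weak_form[OF that] by simp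
  qed (intro continuous_intros continuous_grad)
  then show ?thesis
    by simp
qed

lemma H1_loc: "u \<in> H1_loc \<Omega>"
  unfolding H1_loc_def
proof safe
  fix V assume V: "open V" "compact (closure V)" "closure V \<subseteq> \<Omega>"
  then have V\<Omega>: "V \<subseteq> \<Omega>"
    using closure_subset by blast
  have meas: "set_borel_measurable lborel V h" if "continuous_on (\<Omega> - {0}) h" for h :: "'a \<Rightarrow> real"
    unfolding set_borel_measurable_def using V by (intro borel_measurable_punctured[OF that _ V\<Omega>]) auto
  have int: "set_integrable lborel V h" if "h \<in> L1_loc \<Omega>" for h
    using V(1) by (intro set_integrable_subset[OF L1_loc_D[OF that V(2,3)] _ closure_subset]) simp
  have "u \<in> L2 V"
    unfolding L2_def using meas[OF continuous_u] int[OF L1_loc_terms(2)] by auto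
  moreover have "\<exists>g\<in>L2 V. \<forall>\<phi>\<in>Cinf_c V. distr_partial b (distr_of V u) \<phi> = distr_of V g \<phi>"
    if b: "b \<in> Basis" for b
  proof (intro bexI ballI)
    have c: "continuous_on (\<Omega> - {0}) (\<lambda>x. grad u x \<bullet> b)"
      by (intro continuous_intros continuous_grad)
    have "set_integrable lborel V (\<lambda>x. (grad u x \<bullet> b)\<^sup>2)"
    proof (rule set_integrable_punctured_bound[OF _ _ V\<Omega> int[OF L1_loc_terms(5)]])
      show "\<bar>(grad u x \<bullet> b)\<^sup>2\<bar> \<le> (norm (grad u x))\<^sup>2" for x
        using Basis_le_norm[OF b, of "grad u x"] by (simp add: abs_le_square_iff[symmetric])
    qed (use V c in \<open>auto intro!: continuous_intros\<close>)
    then show "(\<lambda>x. grad u x \<bullet> b) \<in> L2 V"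
      unfolding L2_def using meas[OF c] by auto
    fix \<phi> assume "\<phi> \<in> Cinf_c V"
    then have \<phi>V: "\<phi> \<in> C1_c V"
      by (rule C1_c_if_Cinf_c)
    note \<phi>\<Omega> = C1_c_mono[OF \<phi>V V\<Omega>]
    have 0: "\<phi> x = 0 \<and> grad \<phi> x = 0" if "x \<notin> V" for x
      using C1_cE[OF \<phi>V] that by (metis subsetD)
    have "(LINT x:V|lborel. (grad u x \<bullet> b) * \<phi> x + u x * (grad \<phi> x \<bullet> b)) = 0"
      using integration_by_parts_across_0[OF \<phi>\<Omega> b] 0
      by (subst set_integral_restrict[OF V\<Omega>, symmetric]) auto
    moreover have "set_integrable lborel V (\<lambda>x. (grad u x \<bullet> b) * \<phi> x)"
      "set_integrable lborel V (\<lambda>x. u x * (grad \<phi> x \<bullet> b))"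
      using V(1) by (intro set_integrable_subset[OF _ _ V\<Omega>] set_integrable_L1_loc_mult_C1_c[OF _ \<phi>\<Omega>]
          L1_loc_partial[OF b] L1_loc_terms(1); simp)+
    ultimately show "distr_partial b (distr_of V u) \<phi> = distr_of V (\<lambda>x. grad u x \<bullet> b) \<phi>"
      by (simp add: distr_partial_def distr_of_def)
  qed
  ultimately show "u \<in> H1 V"
    by (simp add: H1_def)
qed

text \<open>Integration by parts across the origin is applied to each partial derivative of \<phi>,
  which is again an admissible C^1 test function. It links the distributional Laplacian to the form
  with one derivative on \<open>u\<close>.\<close>

lemma integral_laplacian:
  assumes "\<phi> \<in> Cinf_c \<Omega>"
  shows "(LINT x:\<Omega>|lborel. u x * laplacian \<phi> x) = - (LINT x:\<Omega>|lborel. grad u x \<bullet> grad \<phi> x)"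
    and "set_integrable lborel \<Omega> (\<lambda>x. grad u x \<bullet> grad \<phi> x)"
proof -
  let ?\<psi> = "\<lambda>b x. grad \<phi> x \<bullet> b"
  have *: "set_integrable lborel \<Omega> (\<lambda>x. u x * (grad (?\<psi> b) x \<bullet> b))"
      "set_integrable lborel \<Omega> (\<lambda>x. (grad u x \<bullet> b) * ?\<psi> b x)"
      "(LINT x:\<Omega>|lborel. u x * (grad (?\<psi> b) x \<bullet> b)) = - (LINT x:\<Omega>|lborel. (grad u x \<bullet> b) * ?\<psi> b x)"
    if b: "b \<in> Basis" for b
  proof -
    note \<psi> = partial_derivative_Cinf_c[OF assms b]
    show 1: "set_integrable lborel \<Omega> (\<lambda>x. u x * (grad (?\<psi> b) x \<bullet> b))"
      by (rule set_integrable_L1_loc_mult_C1_c(2)[OF L1_loc_terms(1) \<psi>])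
    show 2: "set_integrable lborel \<Omega> (\<lambda>x. (grad u x \<bullet> b) * ?\<psi> b x)"
      by (rule set_integrable_L1_loc_mult_C1_c(1)[OF L1_loc_partial[OF b] \<psi>])
    have "(LINT x:\<Omega>|lborel. (grad u x \<bullet> b) * ?\<psi> b x) + (LINT x:\<Omega>|lborel. u x * (grad (?\<psi> b) x \<bullet> b)) = 0"
      using integration_by_parts_across_0[OF \<psi> b] unfolding set_integral_add(2)[OF 2 1] .
    then show "(LINT x:\<Omega>|lborel. u x * (grad (?\<psi> b) x \<bullet> b)) = - (LINT x:\<Omega>|lborel. (grad u x \<bullet> b) * ?\<psi> b x)"
      by simp
  qed
  have inner: "grad u x \<bullet> grad \<phi> x = (\<Sum>b\<in>Basis. (grad u x \<bullet> b) * ?\<psi> b x)" for x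
    by (rule euclidean_inner)
  show "set_integrable lborel \<Omega> (\<lambda>x. grad u x \<bullet> grad \<phi> x)"
    using *(2) unfolding inner set_integrable_def scaleR_sum_right by (rule Bochner_Integration.integrable_sum)
  have "(LINT x:\<Omega>|lborel. u x * laplacian \<phi> x) = (\<Sum>b\<in>Basis. LINT x:\<Omega>|lborel. u x * (grad (?\<psi> b) x \<bullet> b))"
    using *(1) unfolding laplacian_def sum_distrib_left set_lebesgue_integral_def set_integrable_def scaleR_sum_right
    by (rule Bochner_Integration.integral_sum)
  also have "\<dots> = - (\<Sum>b\<in>Basis. LINT x:\<Omega>|lborel. (grad u x \<bullet> b) * ?\<psi> b x)"
    by (simp add: *(3) sum_negf)
  also have "(\<Sum>b\<in>Basis. LINT x:\<Omega>|lborel. (grad u x \<bullet> b) * ?\<psi> b x) = (LINT x:\<Omega>|lborel. grad u x \<bullet> grad \<phi> x)"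
    using *(2) unfolding inner set_lebesgue_integral_def set_integrable_def scaleR_sum_right
    by (rule Bochner_Integration.integral_sum[symmetric])
  finally show "(LINT x:\<Omega>|lborel. u x * laplacian \<phi> x) = - (LINT x:\<Omega>|lborel. grad u x \<bullet> grad \<phi> x)" .
qed

lemma equation_across_0: "L_equation_distr \<rho> lam \<tau> \<Omega> u (\<lambda>x. norm x powr \<theta> * u x powr q)"
  unfolding L_equation_distr_def
proof (intro conjI ballI)
  show lamG: "(\<lambda>x. lam * G \<tau> x (u x) (grad u x)) \<in> L1_loc \<Omega>"
    using L1_loc_terms(7) unfolding L1_loc_def by (auto intro: set_integrable_mult_right)
  fix \<phi> assume \<phi>: "\<phi> \<in> Cinf_c \<Omega>"
  note \<phi>1 = C1_c_if_Cinf_c[OF \<phi>]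
  note int = set_integrable_L1_loc_mult_C1_c(1)[OF _ \<phi>1]
  note i\<^sub>1 = int[OF lamG] and i\<^sub>2 = int[OF L1_loc_terms(6)] and i\<^sub>3 = int[OF L1_loc_terms(8)]
    and i\<^sub>4 = integral_laplacian(2)[OF \<phi>]
  note d\<^sub>1 = set_integral_diff(1)[OF i\<^sub>1 i\<^sub>2]
  note d\<^sub>2 = set_integral_diff(1)[OF d\<^sub>1 i\<^sub>3]
  have "(LINT x:\<Omega>|lborel. lam * G \<tau> x (u x) (grad u x) * \<phi> x - drift \<rho> u x * \<phi> x
      - norm x powr \<theta> * u x powr q * \<phi> x - grad u x \<bullet> grad \<phi> x) = 0"
    using weak_form_across_0[OF \<phi>1] by (simp add: rhs_def left_diff_distrib)
  then have "(LINT x:\<Omega>|lborel. lam * G \<tau> x (u x) (grad u x) * \<phi> x) - (LINT x:\<Omega>|lborel. drift \<rho> u x * \<phi> x)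
      - (LINT x:\<Omega>|lborel. norm x powr \<theta> * u x powr q * \<phi> x) - (LINT x:\<Omega>|lborel. grad u x \<bullet> grad \<phi> x) = 0"
    unfolding set_integral_diff(2)[OF d\<^sub>2 i\<^sub>4] set_integral_diff(2)[OF d\<^sub>1 i\<^sub>3] set_integral_diff(2)[OF i\<^sub>1 i\<^sub>2] .
  then show "distr_laplacian (distr_of \<Omega> u) \<phi> - distr_of \<Omega> (drift \<rho> u) \<phi>
      + distr_of \<Omega> (\<lambda>x. lam * G \<tau> x (u x) (grad u x)) \<phi> = distr_of \<Omega> (\<lambda>x. norm x powr \<theta> * u x powr q) \<phi>"
    using integral_laplacian(1)[OF \<phi>] by (simp add: distr_laplacian_def distr_of_def)
qed (fact L1_loc_terms)+

end

theorem corollaryB4: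
  fixes \<Omega> :: "'a::euclidean_space set" and u :: "'a \<Rightarrow> real"
    and q \<tau> \<rho> lam \<theta> :: real
  assumes "DIM('a) \<ge> 2" and "q > 1" and "0 \<le> \<tau>" and "\<tau> < 1" and "\<theta> < -2"
    and "open \<Omega>" and "connected \<Omega>" and "0 \<in> \<Omega>"
    and "positive_solution \<rho> lam \<tau> \<theta> q \<Omega> u"
  shows "(u \<longlongrightarrow> 0) (at 0) \<and> u \<in> H1_loc \<Omega> \<and>
    L_equation_distr \<rho> lam \<tau> \<Omega> u (\<lambda>x. norm x powr \<theta> * u x powr q)"
proof -
  interpret positive_solution_near_0 \<Omega> u q \<tau> \<rho> lam \<theta>
    using assms by unfold_locales
  show ?thesis
    using tendsto_0_at_0 H1_loc equation_across_0 by blast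
qed

end
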